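(* Let $2\le m<n$. Then the Baumslag–Solitar group $BS(m,n)=\langle a,t\mid ta^mt^{-1}=a^n\rangle$ is blind deterministic $3$-counter-graph automatic; that is, with $X=\{a^{\pm1},t^{\pm1}\}$ there is a finite set of symbols $\Lambda$ such that $(BS(m,n),X,\Lambda)$ is $\mathcal C$-graph automatic, where $\mathcal C$ is the class of languages accepted by blind deterministic $3$-counter automata.
   Context: A normal form for $(G,X,\Lambda)$ is a set $L\subseteq\Lambda^*$ in bijection with $G$; the image of $u\in L$ is denoted $\overline u$. Convolution: let $\diamond\notin\Lambda$ and $\Lambda_\diamond=\Lambda\cup\{\diamond\}$. For $u,v\in\Lambda^*$, $\otimes(u,v)$ is the word of length $\max(|u|,|v|)$ over $(\Lambda_\diamond)^2$ whose $i$th letter has first component the $i$th letter of $u$ if $i\le|u|$ and $\diamond$ otherwise, and second component the $i$th letter of $v$ if $i\le|v|$ and $\diamond$ otherwise. For a group $G$ with symmetric (closed under inverses) generating set $X$ and a finite set of symbols $\Lambda$, $(G,X,\Lambda)$ is $\mathcal C$-graph automatic if there is a normal form $L\subseteq\Lambda^*$ in $\mathcal C$ such that for each $x\in X$ the language $L_x=\{\otimes(u,v)\mid u,v\in L,\ \overline v=_G\overline u x\}$ is in $\mathcal C$. A blind deterministic $k$-counter automaton is a deterministic finite state automaton (without $\epsilon$-transitions) augmented with $k$ integer counters, all initialized to zero, which can be incremented and decremented (by fixed integers) during operation but not read; it accepts a word exactly if, having read it, it is in an accepting state with all counters equal to zero. *)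

theory Defs
  imports "HOL-Algebra.Generated_Groups"
begin

section \<open>Groups given by presentations and Baumslag--Solitar groups\<close>

text \<open>A letter \<open>(g, True)\<close> stands for the generator \<open>g\<close> and \<open>(g, False)\<close> for its formal
  inverse. The group with generating set the whole type \<open>'g\<close> and relations \<open>u = v\<close> for
  \<open>(u, v) \<in> R\<close> is the quotient of the monoid of words by the congruence generated by free
  cancellation and the relations.\<close>

type_synonym 'g word = "('g \<times> bool) list"

inductive pres_eq :: "('g word \<times> 'g word) set \<Rightarrow> 'g word \<Rightarrow> 'g word \<Rightarrow> bool"
  for R :: "('g word \<times> 'g word) set" where
  refl: "pres_eq R u u"
| sym: "pres_eq R u v \<Longrightarrow> pres_eq R v u"
| trans: "pres_eq R u v \<Longrightarrow> pres_eq R v w \<Longrightarrow> pres_eq R u w"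
| cong: "pres_eq R u u' \<Longrightarrow> pres_eq R v v' \<Longrightarrow> pres_eq R (u @ v) (u' @ v')"
| cancel: "pres_eq R [(g, b), (g, \<not> b)] []"
| rel: "(u, v) \<in> R \<Longrightarrow> pres_eq R u v"

definition pres_class :: "('g word \<times> 'g word) set \<Rightarrow> 'g word \<Rightarrow> 'g word set" where
  "pres_class R u = {v. pres_eq R u v}"

definition presented_group :: "('g word \<times> 'g word) set \<Rightarrow> 'g word set monoid" where
  "presented_group R =
     \<lparr> carrier = range (pres_class R),
       monoid.mult = (\<lambda>A B. \<Union>u\<in>A. \<Union>v\<in>B. pres_class R (u @ v)),
       one = pres_class R [] \<rparr>"

datatype bs_gen = Gen_a | Gen_t

definition BS_rels :: "nat \<Rightarrow> nat \<Rightarrow> (bs_gen word \<times> bs_gen word) set" where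
  "BS_rels m n =
     {([(Gen_t, True)] @ replicate m (Gen_a, True) @ [(Gen_t, False)],
       replicate n (Gen_a, True))}"

definition BS :: "nat \<Rightarrow> nat \<Rightarrow> bs_gen word set monoid" where
  "BS m n = presented_group (BS_rels m n)"

definition BS_a :: "nat \<Rightarrow> nat \<Rightarrow> bs_gen word set" where
  "BS_a m n = pres_class (BS_rels m n) [(Gen_a, True)]"

definition BS_t :: "nat \<Rightarrow> nat \<Rightarrow> bs_gen word set" where
  "BS_t m n = pres_class (BS_rels m n) [(Gen_t, True)]"

definition BS_gens :: "nat \<Rightarrow> nat \<Rightarrow> bs_gen word set set" where
  "BS_gens m n =
     {BS_a m n, inv\<^bsub>BS m n\<^esub> BS_a m n, BS_t m n, inv\<^bsub>BS m n\<^esub> BS_t m n}"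

lemma pres_class_eq_iff: "pres_class R u = pres_class R v \<longleftrightarrow> pres_eq R u v"
  unfolding pres_class_def using pres_eq.refl pres_eq.sym pres_eq.trans by blast

lemma pres_class_mult:
  "pres_class R u \<otimes>\<^bsub>presented_group R\<^esub> pres_class R v = pres_class R (u @ v)"
proof -
  have "pres_class R (u' @ v') = pres_class R (u @ v)"
    if "u' \<in> pres_class R u" "v' \<in> pres_class R v" for u' v'
    unfolding pres_class_eq_iff
    by (rule pres_eq.sym, rule pres_eq.cong) (use that in \<open>simp_all add: pres_class_def\<close>)
  then have "(\<Union>u'\<in>pres_class R u. \<Union>v'\<in>pres_class R v. pres_class R (u' @ v')) =
      (\<Union>u'\<in>pres_class R u. \<Union>v'\<in>pres_class R v. pres_class R (u @ v))"
    by (intro SUP_cong) simp_all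
  moreover have "pres_class R u \<noteq> {}" "pres_class R v \<noteq> {}"
    unfolding pres_class_def using pres_eq.refl by blast+
  ultimately show ?thesis
    by (simp add: presented_group_def)
qed

lemma pres_eq_left_inverse:
  "pres_eq R (rev (map (\<lambda>(g, b). (g, \<not> b)) u) @ u) []"
proof (induction u)
  case Nil
  show ?case by (simp add: pres_eq.refl)
next
  case (Cons x u)
  obtain g b where x: "x = (g, b)" by (cases x)
  let ?w = "rev (map (\<lambda>(g, b). (g, \<not> b)) u)"
  have "pres_eq R [(g, \<not> b), (g, b)] []"
    using pres_eq.cancel[of R g "\<not> b"] by simp
  then have "pres_eq R (?w @ [(g, \<not> b), (g, b)] @ u) (?w @ [] @ u)"
    by (rule pres_eq.cong[OF pres_eq.refl pres_eq.cong[OF _ pres_eq.refl]])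
  then have "pres_eq R (?w @ [(g, \<not> b), (g, b)] @ u) []"
    by (rule pres_eq.trans) (simp add: Cons.IH)
  then show ?case
    by (simp add: x)
qed

lemma carrier_presented_group: "carrier (presented_group R) = range (pres_class R)"
  by (simp add: presented_group_def)

lemma one_presented_group: "\<one>\<^bsub>presented_group R\<^esub> = pres_class R []"
  by (simp add: presented_group_def)

lemma group_presented_group: "group (presented_group R)" (is "group ?G")
proof (rule groupI)
  fix x y assume "x \<in> carrier ?G" "y \<in> carrier ?G"
  then show "x \<otimes>\<^bsub>?G\<^esub> y \<in> carrier ?G"
    by (auto simp: carrier_presented_group pres_class_mult)
next
  show "\<one>\<^bsub>?G\<^esub> \<in> carrier ?G"
    by (simp add: carrier_presented_group one_presented_group)
next
  fix x y z assume "x \<in> carrier ?G" "y \<in> carrier ?G" "z \<in> carrier ?G"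
  then show "x \<otimes>\<^bsub>?G\<^esub> y \<otimes>\<^bsub>?G\<^esub> z = x \<otimes>\<^bsub>?G\<^esub> (y \<otimes>\<^bsub>?G\<^esub> z)"
    by (auto simp: carrier_presented_group pres_class_mult)
next
  fix x assume "x \<in> carrier ?G"
  then show "\<one>\<^bsub>?G\<^esub> \<otimes>\<^bsub>?G\<^esub> x = x"
    by (auto simp: carrier_presented_group one_presented_group pres_class_mult)
next
  fix x assume "x \<in> carrier ?G"
  then obtain u where x: "x = pres_class R u"
    by (auto simp: carrier_presented_group)
  let ?y = "pres_class R (rev (map (\<lambda>(g, b). (g, \<not> b)) u))"
  have "?y \<otimes>\<^bsub>?G\<^esub> x = \<one>\<^bsub>?G\<^esub>"
    unfolding x pres_class_mult one_presented_group pres_class_eq_iff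
    by (rule pres_eq_left_inverse)
  moreover have "?y \<in> carrier ?G"
    by (simp add: carrier_presented_group)
  ultimately show "\<exists>y\<in>carrier ?G. y \<otimes>\<^bsub>?G\<^esub> x = \<one>\<^bsub>?G\<^esub>"
    by blast
qed

lemma group_BS: "group (BS m n)"
  unfolding BS_def by (rule group_presented_group)

section \<open>Blind deterministic counter automata\<close>

text \<open>On reading \<open>x\<close> in state \<open>q\<close>, the automaton moves to \<open>bca_trans M q x\<close> and adds the integer
  \<open>bca_incr M q x i\<close> to counter \<open>i\<close>. The automaton has \<open>k\<close> counters, numbered \<open>0, \<dots>, k - 1\<close>;
  entries of a counter vector at other indices are irrelevant to acceptance.\<close>

record ('s, 'a) bca =
  bca_alphabet :: "'a set"
  bca_states :: "'s set"
  bca_initial :: "'s"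
  bca_accepting :: "'s set"
  bca_trans :: "'s \<Rightarrow> 'a \<Rightarrow> 's"
  bca_incr :: "'s \<Rightarrow> 'a \<Rightarrow> nat \<Rightarrow> int"

definition bca_wf :: "('s, 'a) bca \<Rightarrow> bool" where
  "bca_wf M \<longleftrightarrow>
     finite (bca_alphabet M) \<and> finite (bca_states M) \<and>
     bca_initial M \<in> bca_states M \<and> bca_accepting M \<subseteq> bca_states M \<and>
     (\<forall>q\<in>bca_states M. \<forall>x\<in>bca_alphabet M. bca_trans M q x \<in> bca_states M)"

fun bca_run :: "('s, 'a) bca \<Rightarrow> 's \<Rightarrow> (nat \<Rightarrow> int) \<Rightarrow> 'a list \<Rightarrow> 's \<times> (nat \<Rightarrow> int)" where
  "bca_run M q c [] = (q, c)"
| "bca_run M q c (x # w) = bca_run M (bca_trans M q x) (\<lambda>i. c i + bca_incr M q x i) w"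

definition bca_language :: "nat \<Rightarrow> ('s, 'a) bca \<Rightarrow> 'a list set" where
  "bca_language k M =
     {w \<in> lists (bca_alphabet M).
        case bca_run M (bca_initial M) (\<lambda>_. 0) w of
          (q, c) \<Rightarrow> q \<in> bca_accepting M \<and> (\<forall>i<k. c i = 0)}"

text \<open>States are taken from \<open>nat\<close>, which is no restriction since there are finitely many.\<close>

definition blind_counter_languages :: "nat \<Rightarrow> 'a list set set" where
  "blind_counter_languages k = {bca_language k M | M :: (nat, 'a) bca. bca_wf M}"

section \<open>Graph automatic groups\<close>

text \<open>The padding symbol is \<open>None\<close>, so \<open>'l option\<close> plays the role of the padded alphabet.\<close>

definition convolution :: "'l list \<Rightarrow> 'l list \<Rightarrow> ('l option \<times> 'l option) list" where
  "convolution u v =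
     map (\<lambda>i. (if i < length u then Some (u ! i) else None,
               if i < length v then Some (v ! i) else None))
       [0..<max (length u) (length v)]"

text \<open>A class of languages contains languages over different alphabets, but a variable has only
  one type. The class is therefore passed twice: \<open>C\<close> is its part over the symbols of \<open>\<Lambda>\<close> and
  \<open>C'\<close> its part over pairs of padded symbols. The map \<open>nf\<close> is the bijection from
  the normal form \<open>L\<close> onto the group.\<close>

definition graph_automatic ::
  "'l list set set \<Rightarrow> ('l option \<times> 'l option) list set set \<Rightarrow>
   ('g, 'b) monoid_scheme \<Rightarrow> 'g set \<Rightarrow> 'l set \<Rightarrow> bool" where
  "graph_automatic C C' G X \<Lambda> \<longleftrightarrow>
     group G \<and> X \<subseteq> carrier G \<and> (\<forall>x\<in>X. inv\<^bsub>G\<^esub> x \<in> X) \<and> generate G X = carrier G \<and>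
     finite \<Lambda> \<and>
     (\<exists>L nf. L \<subseteq> lists \<Lambda> \<and> bij_betw nf L (carrier G) \<and> L \<in> C \<and>
        (\<forall>x\<in>X. {convolution u v | u v. u \<in> L \<and> v \<in> L \<and> nf v = nf u \<otimes>\<^bsub>G\<^esub> x} \<in> C'))"

end

theory Submission
  imports Defs "HOL-Library.Countable"
begin

text \<open>The normal forms come from the structure of the group as an HNN extension. Every element is, in
  exactly one way, a product of syllables \<open>a\<^sup>r t\<close> with \<open>r < n\<close> and \<open>a\<^sup>r t\<^sup>-\<^sup>1\<close> with \<open>r < m\<close>, followed by a
  power \<open>a\<^sup>N\<close> with \<open>N\<close> an integer, where no syllable \<open>a\<^sup>0 t\<^sup>\<plusminus>\<^sup>1\<close> follows a syllable with the opposite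
  power of \<open>t\<close>. There are finitely many syllables, so each can be one symbol, and \<open>N\<close> is written in
  unary with a sign. These words form a regular language.

  Right multiplication by \<open>a\<^sup>\<plusminus>\<^sup>1\<close> appends or removes one letter, which a finite automaton can check.
  Right multiplication by \<open>t\<close> uses \<open>a\<^sup>n t = t a\<^sup>m\<close>: if \<open>N = n q + r\<close> with \<open>0 \<le> r < n\<close>, then
  \<open>a\<^sup>N t = a\<^sup>r t a\<^bsup>m q\<^esup>\<close>. So the syllables stay the same except that one is added, or, if \<open>r = 0\<close> and
  the last syllable is some \<open>a\<^sup>s t\<^sup>-\<^sup>1\<close>, that this syllable disappears and adds \<open>s\<close> to the exponent.
  After the common syllables it remains to compare two unary numbers through a linear equation, for
  which one blind counter suffices because the tails are read in parallel, and to check a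
  residue modulo \<open>n\<close>, which the finite control does. Multiplication by \<open>t\<^sup>-\<^sup>1\<close> is the same with \<open>m\<close> and \<open>n\<close>
  exchanged.

  That the normal forms are unique is shown by letting the generators act on them as just described
  and checking the relations for this action (\<open>fold_act_pres_eq\<close>, from \<open>move_inverse_shift\<close>); that
  every element has one follows since the action is right multiplication (\<open>eval_encode_act\<close>).
  Together these give \<open>bij_betw_eval\<close>. The automata are never run: by
  \<open>blind_counter_languageI_residuals\<close> it is enough to exhibit, for finitely many states and each
  value of the counter, the language that remains to be read, and to see how a first letter changes
  state and counter.\<close>

section \<open>Blind counter languages through residual languages\<close>

text \<open>A deterministic machine is determined by what it still accepts: \<open>K q c\<close> is the set of words that lead
  from state \<open>q\<close> with counter value \<open>c\<close> to acceptance. So a finite family of such sets that is closed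
  under removing a first letter already is an automaton, provided that the new state and the change
  of the counter do not depend on the counter, which the machine cannot read. At the end of the
  word acceptance depends on the state and on \<open>c = 0\<close>. With this criterion no run ever has
  to be analysed: membership in the class becomes one local statement per letter.\<close>

lemma blind_counter_languageI_residuals:
  fixes K :: "'s \<Rightarrow> int \<Rightarrow> 'a list set"
  assumes k: "0 < k" and S: "finite S" "q0 \<in> S" and \<Sigma>: "finite \<Sigma>"
    and sub: "\<And>q c. q \<in> S \<Longrightarrow> K q c \<subseteq> lists \<Sigma>"
    and nil: "\<And>q c. q \<in> S \<Longrightarrow> [] \<in> K q c \<longleftrightarrow> [] \<in> K q 0 \<and> c = 0"
    and cons: "\<And>q x. q \<in> S \<Longrightarrow> x \<in> \<Sigma> \<Longrightarrow>
      (\<forall>c w. x # w \<notin> K q c) \<or> (\<exists>q'\<in>S. \<exists>e. \<forall>c w. x # w \<in> K q c \<longleftrightarrow> w \<in> K q' (c + e))"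
  shows "K q0 0 \<in> blind_counter_languages k"
proof -
  \<comment> \<open>A dead state \<open>None\<close> receives the letters after which nothing is accepted.\<close>
  define K' where "K' = (\<lambda>q c. case q of None \<Rightarrow> {} | Some q \<Rightarrow> K q c)"
  define S' where "S' = insert None (Some ` S)"
  have "\<exists>s. fst s \<in> S' \<and> (\<forall>c w. x # w \<in> K' q c \<longleftrightarrow> w \<in> K' (fst s) (c + snd s))"
    if "q \<in> S'" "x \<in> \<Sigma>" for q x
  proof (cases q)
    case None
    then show ?thesis
      by (intro exI[of _ "(None, 0)"]) (simp add: K'_def S'_def)
  next
    case (Some p)
    then have p: "p \<in> S"
      using that by (auto simp: S'_def)
    from cons[OF p that(2)] show ?thesis
    proof
      assume "\<forall>c w. x # w \<notin> K p c"
      then show ?thesis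
        by (intro exI[of _ "(None, 0)"]) (simp add: K'_def S'_def Some)
    next
      assume "\<exists>q'\<in>S. \<exists>e. \<forall>c w. x # w \<in> K p c \<longleftrightarrow> w \<in> K q' (c + e)"
      then obtain q' e where "q' \<in> S" "\<forall>c w. x # w \<in> K p c \<longleftrightarrow> w \<in> K q' (c + e)"
        by blast
      then show ?thesis
        by (intro exI[of _ "(Some q', e)"]) (simp add: K'_def S'_def Some)
    qed
  qed
  then obtain step where step: "\<And>q x. q \<in> S' \<Longrightarrow> x \<in> \<Sigma> \<Longrightarrow> fst (step q x) \<in> S'"
    "\<And>q x c w. q \<in> S' \<Longrightarrow> x \<in> \<Sigma> \<Longrightarrow>
      x # w \<in> K' q c \<longleftrightarrow> w \<in> K' (fst (step q x)) (c + snd (step q x))"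
    by metis
  \<comment> \<open>The finitely many states are numbered by \<open>f\<close>; only counter \<open>0\<close> ever moves.\<close>
  have fin: "finite S'"
    using S by (simp add: S'_def)
  then obtain f :: "'s option \<Rightarrow> nat" where f: "inj_on f S'"
    using finite_imp_inj_to_nat_seg by meson
  define g where "g = inv_into S' f"
  have g [simp]: "g (f q) = q" if "q \<in> S'" for q
    using that f by (simp add: g_def)
  define M where "M = \<lparr>bca_alphabet = \<Sigma>, bca_states = f ` S', bca_initial = f (Some q0),
    bca_accepting = f ` {q \<in> S'. [] \<in> K' q 0},
    bca_trans = (\<lambda>p x. f (fst (step (g p) x))),
    bca_incr = (\<lambda>p x i. if i = 0 then snd (step (g p) x) else 0)\<rparr>"
  have "bca_wf M"
    using fin \<Sigma> S step(1) by (auto simp: bca_wf_def M_def S'_def[symmetric]) (auto simp: S'_def)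
  moreover have run: "(case bca_run M (f q) c w of
        (p, c') \<Rightarrow> p \<in> bca_accepting M \<and> (\<forall>i<k. c' i = 0)) \<longleftrightarrow> w \<in> K' q (c 0)"
    if "w \<in> lists \<Sigma>" "q \<in> S'" "\<forall>i. i \<noteq> 0 \<longrightarrow> c i = 0" for w q c
    using that
  proof (induction w arbitrary: q c rule: list.induct)
    case Nil
    have "f q \<in> bca_accepting M \<longleftrightarrow> [] \<in> K' q 0"
      using Nil.prems f by (auto simp: M_def inj_on_def)
    moreover have "(\<forall>i<k. c i = 0) \<longleftrightarrow> c 0 = 0"
      using Nil.prems k by (metis neq0_conv)
    moreover have "[] \<in> K' q (c 0) \<longleftrightarrow> [] \<in> K' q 0 \<and> c 0 = 0"
      using Nil.prems nil by (auto simp: K'_def S'_def split: option.splits)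
    ultimately show ?case
      by simp
  next
    case (Cons x w)
    have x: "x \<in> \<Sigma>" "w \<in> lists \<Sigma>"
      using \<open>x # w \<in> lists \<Sigma>\<close> by (simp_all del: in_lists_conv_set)
    have t: "bca_trans M (f q) x = f (fst (step q x))"
      "bca_incr M (f q) x i = (if i = 0 then snd (step q x) else 0)" for i
      using Cons.prems by (simp_all add: M_def)
    show ?case
      unfolding bca_run.simps t
      by (subst Cons.IH) (use Cons.prems x step in auto)
  qed
  have "bca_language k M = K q0 0"
  proof -
    have init: "bca_alphabet M = \<Sigma>" "bca_initial M = f (Some q0)"
      by (simp_all add: M_def)
    have q0: "Some q0 \<in> S'"
      using S by (simp add: S'_def)
    have "w \<in> bca_language k M \<longleftrightarrow> w \<in> lists \<Sigma> \<and> w \<in> K' (Some q0) 0" for w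
      unfolding bca_language_def init mem_Collect_eq
      by (rule conj_cong[OF HOL.refl]) (rule run[OF _ q0], simp_all)
    then show ?thesis
      using sub[OF S(2)] by (auto simp: K'_def)
  qed
  ultimately show ?thesis
    unfolding blind_counter_languages_def by blast
qed

section \<open>Renaming symbols\<close>

lemma blind_counter_languages_image:
  assumes "L \<in> blind_counter_languages k" and f: "inj f"
  shows "map f ` L \<in> blind_counter_languages k"
proof -
  obtain M :: "(nat, 'a) bca" where M: "bca_wf M" "L = bca_language k M"
    using assms(1) by (auto simp: blind_counter_languages_def)
  define M' where "M' = \<lparr>bca_alphabet = f ` bca_alphabet M, bca_states = bca_states M,
    bca_initial = bca_initial M, bca_accepting = bca_accepting M,
    bca_trans = (\<lambda>q x. bca_trans M q (inv_into UNIV f x)), bca_incr = (\<lambda>q x. bca_incr M q (inv_into UNIV f x))\<rparr>"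
  have "bca_run M' q c (map f w) = bca_run M q c w" for q c w
    by (induction w arbitrary: q c) (simp_all add: M'_def f)
  then have "map f w \<in> bca_language k M' \<longleftrightarrow> w \<in> bca_language k M" if "w \<in> lists (bca_alphabet M)" for w
    using that by (auto simp: bca_language_def M'_def)
  moreover have "bca_language k M' \<subseteq> map f ` lists (bca_alphabet M)"
    by (auto simp: bca_language_def M'_def lists_image)
  moreover have "bca_language k M \<subseteq> lists (bca_alphabet M)"
    by (auto simp: bca_language_def)
  ultimately have "map f ` L = bca_language k M'"
    unfolding M(2) by blast
  moreover have "bca_wf M'"
    using M(1) f by (auto simp: bca_wf_def M'_def)
  ultimately show ?thesis
    unfolding blind_counter_languages_def by blast
qed

lemma convolution_map:
  "convolution (map f u) (map f v) = map (map_prod (map_option f) (map_option f)) (convolution u v)"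
  by (auto simp: convolution_def)

text \<open>Symbols may be renamed injectively, so a countable type of symbols can be replaced by the natural
  numbers.\<close>

lemma graph_automatic_nat_alphabet:
  fixes \<Lambda> :: "'l::countable set"
  assumes "graph_automatic (blind_counter_languages j) (blind_counter_languages k) G X \<Lambda>"
  shows "\<exists>\<Lambda>' :: nat set.
    graph_automatic (blind_counter_languages j) (blind_counter_languages k) G X \<Lambda>'"
proof -
  let ?f = "to_nat :: 'l \<Rightarrow> nat"
  let ?F = "map_prod (map_option ?f) (map_option ?f)"
  obtain L nf where L: "L \<subseteq> lists \<Lambda>" "bij_betw nf L (carrier G)"
      "L \<in> blind_counter_languages j"
    and Lx: "\<And>x. x \<in> X \<Longrightarrow> {convolution u v | u v. u \<in> L \<and> v \<in> L \<and> nf v = nf u \<otimes>\<^bsub>G\<^esub> x}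
      \<in> blind_counter_languages k"
    using assms unfolding graph_automatic_def by blast
  have inj: "inj (map ?f)"
    by simp
  define nf' where "nf' = nf \<circ> inv_into UNIV (map ?f)"
  have nf': "nf' (map ?f u) = nf u" for u
    by (simp add: nf'_def inv_f_f[OF inj])
  have "bij_betw nf' (map ?f ` L) (carrier G)"
    unfolding nf'_def
    by (rule bij_betw_trans[OF _ L(2)]) (auto simp: bij_betw_def inj_on_def image_image inj inv_f_f[OF inj])
  moreover have "map ?f ` L \<subseteq> lists (?f ` \<Lambda>)"
    using L(1) by (auto simp: lists_image)
  moreover have "map ?f ` L \<in> blind_counter_languages j"
    using L(3) by (rule blind_counter_languages_image) simp
  moreover have "{convolution u v | u v. u \<in> map ?f ` L \<and> v \<in> map ?f ` L \<and> nf' v = nf' u \<otimes>\<^bsub>G\<^esub> x}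
      \<in> blind_counter_languages k" if "x \<in> X" for x
  proof -
    have "{convolution u v | u v. u \<in> map ?f ` L \<and> v \<in> map ?f ` L \<and> nf' v = nf' u \<otimes>\<^bsub>G\<^esub> x}
      = map ?F ` {convolution u v | u v. u \<in> L \<and> v \<in> L \<and> nf v = nf u \<otimes>\<^bsub>G\<^esub> x}"
      by (auto simp: nf' convolution_map[symmetric] image_iff) (metis nf' convolution_map)+
    moreover have "inj ?F"
      by (intro prod.inj_map option.inj_map) simp_all
    ultimately show ?thesis
      using blind_counter_languages_image[OF Lx[OF that], of ?F] by simp
  qed
  ultimately show ?thesis
    using assms unfolding graph_automatic_def
    by (intro exI[of _ "?f ` \<Lambda>"]) blast
qed

section \<open>Reading convolutions letter by letter\<close>

lemma convolution_Nil [simp]: "convolution [] [] = []"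
  by (simp add: convolution_def)

lemma length_convolution: "length (convolution u v) = max (length u) (length v)"
  by (simp add: convolution_def)

lemma nth_convolution:
  "i < max (length u) (length v) \<Longrightarrow> convolution u v ! i =
    (if i < length u then Some (u ! i) else None, if i < length v then Some (v ! i) else None)"
  by (simp add: convolution_def)

lemma convolution_unfold:
  assumes "u \<noteq> [] \<or> v \<noteq> []"
  shows "convolution u v = (case u of [] \<Rightarrow> None | x # _ \<Rightarrow> Some x, case v of [] \<Rightarrow> None | x # _ \<Rightarrow> Some x)
    # convolution (tl u) (tl v)"
proof -
  show ?thesis
  proof (rule nth_equalityI)
    show len: "length (convolution u v) = length ((case u of [] \<Rightarrow> None | x # _ \<Rightarrow> Some x,
      case v of [] \<Rightarrow> None | x # _ \<Rightarrow> Some x) # convolution (tl u) (tl v))"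
      using assms by (cases u; cases v) (auto simp: length_convolution)
    fix i assume "i < length (convolution u v)"
    then show "convolution u v ! i = ((case u of [] \<Rightarrow> None | x # _ \<Rightarrow> Some x,
      case v of [] \<Rightarrow> None | x # _ \<Rightarrow> Some x) # convolution (tl u) (tl v)) ! i"
      using len by (cases i; cases u; cases v) (auto simp: length_convolution nth_convolution)
  qed
qed

definition opt_list :: "'a option \<Rightarrow> 'a list" where
  "opt_list y = (case y of None \<Rightarrow> [] | Some x \<Rightarrow> [x])"

lemma opt_list_simps [simp]: "opt_list None = []" "opt_list (Some x) = [x]"
  by (simp_all add: opt_list_def)

text \<open>Reading one letter of a convolution consumes the first letter of each track. A padded track is
  exhausted, which is why \<open>None\<close> forces the rest of that track to be empty.\<close>

lemma Cons_eq_convolution_iff: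
  "(y, z) # w = convolution u v \<longleftrightarrow> (y \<noteq> None \<or> z \<noteq> None) \<and>
    (\<exists>u' v'. u = opt_list y @ u' \<and> v = opt_list z @ v' \<and> (y = None \<longrightarrow> u' = []) \<and> (z = None \<longrightarrow> v' = []) \<and>
      w = convolution u' v')"
proof (cases "u = [] \<and> v = []")
  case True
  then show ?thesis by (auto simp: opt_list_def split: option.splits)
next
  case False
  then have "u \<noteq> [] \<or> v \<noteq> []"
    by simp
  from convolution_unfold[OF this] show ?thesis
    by (cases u; cases v; cases y; cases z) auto
qed

lemma convolution_in_lists:
  "u \<in> lists \<Lambda> \<Longrightarrow> v \<in> lists \<Lambda> \<Longrightarrow>
    convolution u v \<in> lists (insert None (Some ` \<Lambda>) \<times> insert None (Some ` \<Lambda>))"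
  by (auto simp: convolution_def in_lists_conv_set)

text \<open>The residual criterion for languages of convolutions, stated for the pairs of words themselves.\<close>

lemma blind_counter_convolutionI_residuals:
  fixes R :: "'s \<Rightarrow> int \<Rightarrow> ('l list \<times> 'l list) set"
  assumes k: "0 < k" and S: "finite S" "q0 \<in> S" and \<Lambda>: "finite \<Lambda>"
    and sub: "\<And>q c. q \<in> S \<Longrightarrow> R q c \<subseteq> lists \<Lambda> \<times> lists \<Lambda>"
    and nil: "\<And>q c. q \<in> S \<Longrightarrow> ([], []) \<in> R q c \<longleftrightarrow> ([], []) \<in> R q 0 \<and> c = 0"
    and cons: "\<And>q y z. q \<in> S \<Longrightarrow> y \<noteq> None \<or> z \<noteq> None \<Longrightarrow>
      (\<forall>c u v. (y = None \<longrightarrow> u = []) \<longrightarrow> (z = None \<longrightarrow> v = []) \<longrightarrow> (opt_list y @ u, opt_list z @ v) \<notin> R q c) \<or>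
      (\<exists>q'\<in>S. \<exists>e. \<forall>c u v.
        (y = None \<longrightarrow> u = []) \<and> (z = None \<longrightarrow> v = []) \<and> (opt_list y @ u, opt_list z @ v) \<in> R q c \<longleftrightarrow>
        (u, v) \<in> R q' (c + e))"
  shows "{convolution u v | u v. (u, v) \<in> R q0 0} \<in> blind_counter_languages k"
proof -
  define K where "K = (\<lambda>q c. {convolution u v | u v. (u, v) \<in> R q c})"
  have nil_iff: "[] = convolution u v \<longleftrightarrow> u = [] \<and> v = []" for u v :: "'l list"
    by (auto simp: convolution_def)
  have cons_iff: "(y, z) # w \<in> K q c \<longleftrightarrow> (y \<noteq> None \<or> z \<noteq> None) \<and> (\<exists>u v. w = convolution u v \<and>
      (y = None \<longrightarrow> u = []) \<and> (z = None \<longrightarrow> v = []) \<and> (opt_list y @ u, opt_list z @ v) \<in> R q c)" for y z w q c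
    unfolding K_def mem_Collect_eq Cons_eq_convolution_iff by blast
  have "K q0 0 \<in> blind_counter_languages k"
  proof (rule blind_counter_languageI_residuals[OF k S])
    show "finite (insert None (Some ` \<Lambda>) \<times> insert None (Some ` \<Lambda>))"
      using \<Lambda> by simp
    show "K q c \<subseteq> lists (insert None (Some ` \<Lambda>) \<times> insert None (Some ` \<Lambda>))" if "q \<in> S" for q c
    proof
      fix w assume "w \<in> K q c"
      then obtain u v where "w = convolution u v" "(u, v) \<in> R q c"
        unfolding K_def by blast
      moreover have "u \<in> lists \<Lambda>" "v \<in> lists \<Lambda>"
        using subsetD[OF sub[OF that] \<open>(u, v) \<in> R q c\<close>] unfolding mem_Times_iff by simp_all
      ultimately show "w \<in> lists (insert None (Some ` \<Lambda>) \<times> insert None (Some ` \<Lambda>))"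
        by (simp only: convolution_in_lists)
    qed
    show "[] \<in> K q c \<longleftrightarrow> [] \<in> K q 0 \<and> c = 0" if "q \<in> S" for q c
      using nil[OF that, of c] by (simp add: K_def nil_iff)
    show "(\<forall>c w. x # w \<notin> K q c) \<or> (\<exists>q'\<in>S. \<exists>e. \<forall>c w. x # w \<in> K q c \<longleftrightarrow> w \<in> K q' (c + e))"
      if "q \<in> S" for q x
    proof -
      obtain y z where x: "x = (y, z)" by (cases x)
      show ?thesis
      proof (cases "y \<noteq> None \<or> z \<noteq> None")
        case True
        from cons[OF that True] show ?thesis
        proof
          assume "\<forall>c u v. (y = None \<longrightarrow> u = []) \<longrightarrow> (z = None \<longrightarrow> v = []) \<longrightarrow>
            (opt_list y @ u, opt_list z @ v) \<notin> R q c"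
          then show ?thesis
            unfolding x cons_iff by blast
        next
          assume "\<exists>q'\<in>S. \<exists>e. \<forall>c u v. (y = None \<longrightarrow> u = []) \<and> (z = None \<longrightarrow> v = []) \<and>
            (opt_list y @ u, opt_list z @ v) \<in> R q c \<longleftrightarrow> (u, v) \<in> R q' (c + e)"
          then obtain q' e where q': "q' \<in> S" and eq: "\<And>c u v. (y = None \<longrightarrow> u = []) \<and> (z = None \<longrightarrow> v = []) \<and>
            (opt_list y @ u, opt_list z @ v) \<in> R q c \<longleftrightarrow> (u, v) \<in> R q' (c + e)"
            by blast
          have "x # w \<in> K q c \<longleftrightarrow> w \<in> K q' (c + e)" for c w
            unfolding x cons_iff eq using True by (auto simp: K_def)
          with q' show ?thesis by blast
        qed
      qed (auto simp: x cons_iff)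
    qed
  qed
  then show ?thesis
    by (simp add: K_def)
qed

section \<open>Normal forms in Baumslag--Solitar groups\<close>

text \<open>\<open>Turn b r\<close> stands for the syllable \<open>a\<^sup>r t\<close> or \<open>a\<^sup>r t\<^sup>-\<^sup>1\<close>, according to \<open>b\<close>, and \<open>Step b\<close> for
  \<open>a\<close> or \<open>a\<^sup>-\<^sup>1\<close>. A syllable is a single symbol because its exponent is bounded.\<close>

datatype letter = Turn bool nat | Step bool

instance letter :: countable
  by countable_datatype

definition turns :: "(bool \<times> nat) list \<Rightarrow> letter list" where
  "turns Q = map (case_prod Turn) Q"

definition steps :: "int \<Rightarrow> letter list" where
  "steps N = replicate (nat \<bar>N\<bar>) (Step (0 \<le> N))"

definition unit_of :: "bool \<Rightarrow> int" where
  "unit_of b = (if b then 1 else - 1)"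

fun encode :: "(bool \<times> nat) list \<times> int \<Rightarrow> letter list" where
  "encode (Q, N) = turns Q @ steps N"

fun spell :: "letter \<Rightarrow> bs_gen word" where
  "spell (Turn b r) = replicate r (Gen_a, True) @ [(Gen_t, b)]"
| "spell (Step b) = [(Gen_a, b)]"

lemma turns_simps [simp]: "turns [] = []" "turns (x # Q) = case_prod Turn x # turns Q"
  "turns (Q @ Q') = turns Q @ turns Q'"
  by (simp_all add: turns_def)

lemma steps_0 [simp]: "steps 0 = []"
  by (simp add: steps_def)

lemma (in group) int_pow_slide:
  assumes "x \<in> carrier G" "y \<in> carrier G" "g \<in> carrier G" "x \<otimes> g = g \<otimes> y"
  shows "x [^] (q :: int) \<otimes> g = g \<otimes> y [^] q"
proof (induction q rule: int_induct[where k = 0])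
  case base
  show ?case using assms by simp
next
  case (step1 i)
  then show ?case
    using assms by (simp add: int_pow_mult m_assoc) (simp flip: m_assoc)
next
  case (step2 i)
  have "x [^] i = x [^] (i - 1) \<otimes> x" "y [^] i = y [^] (i - 1) \<otimes> y"
    using assms int_pow_mult[of _ "i - 1" 1] by simp_all
  then have "x [^] (i - 1) \<otimes> g \<otimes> y = g \<otimes> y [^] (i - 1) \<otimes> y"
    using step2.IH assms by (simp add: m_assoc)
  then show ?case
    using assms by simp
qed

locale baumslag_solitar =
  fixes m n :: nat
  assumes m_pos: "0 < m" and n_pos: "0 < n"
begin

text \<open>With \<open>d = per b\<close> and \<open>d' = per (\<not> b)\<close>, the relation of the group says that \<open>a\<^sup>d\<close> followed by \<open>t\<close>
  (if \<open>b\<close>) or \<open>t\<^sup>-\<^sup>1\<close> (if not) equals the same letter followed by \<open>a\<^bsup>d'\<^esup>\<close>.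
  This makes the two directions symmetric, so each fact below is proved once, for a sign \<open>b\<close>.\<close>

definition per :: "bool \<Rightarrow> nat" where
  "per b = (if b then n else m)"

lemma per_pos [simp]: "0 < per b"
  using m_pos n_pos by (simp add: per_def)

lemma per_nonzero [simp]: "per b \<noteq> 0"
  using per_pos[of b] by simp

text \<open>The first argument is the sign of the syllable just before the list, if there is one. A syllable
  without any \<open>a\<close> must not undo the \<open>t\<^sup>\<plusminus>\<^sup>1\<close> that precedes it.\<close>

fun reduced :: "bool option \<Rightarrow> (bool \<times> nat) list \<Rightarrow> bool" where
  "reduced p [] \<longleftrightarrow> True"
| "reduced p ((b, r) # Q) \<longleftrightarrow> r < per b \<and> (r = 0 \<longrightarrow> p \<noteq> Some (\<not> b)) \<and> reduced (Some b) Q"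

lemma reduced_snoc:
  "reduced p (Q @ [(b, r)]) \<longleftrightarrow>
    reduced p Q \<and> r < per b \<and> (r = 0 \<longrightarrow> (if Q = [] then p else Some (fst (last Q))) \<noteq> Some (\<not> b))"
  by (induction p Q rule: reduced.induct) auto

text \<open>The pair \<open>(Q, N)\<close> represents the product of the syllables in \<open>Q\<close> and \<open>a\<^sup>N\<close>.\<close>

definition configs :: "((bool \<times> nat) list \<times> int) set" where
  "configs = {Q. reduced None Q} \<times> UNIV"

text \<open>Right multiplication by \<open>t\<close> or \<open>t\<^sup>-\<^sup>1\<close>. Writing \<open>N = d q + r\<close> with \<open>0 \<le> r < d\<close>, the power \<open>a\<^bsup>d q\<^esup>\<close>
  slides through the letter and becomes \<open>a\<^bsup>d' q\<^esup>\<close>; what remains before it is \<open>a\<^sup>r\<close>, which either forms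
  a new syllable or, for \<open>r = 0\<close>, lets the letter cancel against an opposite last syllable. That
  syllable's own power of \<open>a\<close> is then released into the tail.\<close>

fun move :: "bool \<Rightarrow> (bool \<times> nat) list \<times> int \<Rightarrow> (bool \<times> nat) list \<times> int" where
  "move b (Q, N) =
    (if int (per b) dvd N \<and> Q \<noteq> [] \<and> fst (last Q) = (\<not> b)
     then (butlast Q, int (per (\<not> b)) * (N div int (per b)) + int (snd (last Q)))
     else (Q @ [(b, nat (N mod int (per b)))], int (per (\<not> b)) * (N div int (per b))))"

fun act :: "bs_gen \<times> bool \<Rightarrow> (bool \<times> nat) list \<times> int \<Rightarrow> (bool \<times> nat) list \<times> int" where
  "act (Gen_a, b) (Q, N) = (Q, N + unit_of b)"
| "act (Gen_t, b) s = move b s"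

lemma move_cases:
  assumes "s \<in> configs"
  obtains (push) Q r q where "s = (Q, int (per b) * q + int r)" "reduced None (Q @ [(b, r)])"
      "move b s = (Q @ [(b, r)], int (per (\<not> b)) * q)"
  | (cancel) Q r q where "s = (Q @ [(\<not> b, r)], int (per b) * q)" "reduced None (Q @ [(\<not> b, r)])"
      "move b s = (Q, int (per (\<not> b)) * q + int r)"
proof -
  obtain Q N where s: "s = (Q, N)" "reduced None Q"
    using assms by (auto simp: configs_def)
  show ?thesis
  proof (cases "int (per b) dvd N \<and> Q \<noteq> [] \<and> fst (last Q) = (\<not> b)")
    case True
    then obtain Q' r where Q: "Q = Q' @ [(\<not> b, r)]"
      by (cases Q rule: rev_cases) (auto simp: prod_eq_iff)
    show ?thesis
      using s True by (intro cancel[of Q' r "N div int (per b)"]) (simp_all add: Q)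
  next
    case False
    have "nat (N mod int (per b)) < per b"
      using per_pos[of b] by (simp add: nat_less_iff)
    moreover have "nat (N mod int (per b)) = 0 \<longleftrightarrow> int (per b) dvd N"
      using pos_mod_sign[of "int (per b)" N] per_pos[of b] by (simp only: dvd_eq_mod_eq_0) linarith
    ultimately show ?thesis
      using s False
      by (intro push[of Q "N div int (per b)" "nat (N mod int (per b))"]) (auto simp: reduced_snoc)
  qed
qed

lemma move_push:
  assumes "reduced None (Q @ [(b, r)])"
  shows "move b (Q, int (per b) * q + int r) = (Q @ [(b, r)], int (per (\<not> b)) * q)"
proof -
  have r: "r < per b"
    using assms by (simp add: reduced_snoc)
  have "(int (per b) * q + int r) mod int (per b) = int r" "(int (per b) * q + int r) div int (per b) = q"
    using r by simp_all
  moreover have "int (per b) dvd int (per b) * q + int r \<longleftrightarrow> r = 0"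
    using r by (simp add: dvd_add_right_iff) (auto dest: dvd_imp_le)
  ultimately show ?thesis
    using assms by (auto simp: reduced_snoc)
qed

lemma move_cancel:
  "move b (Q @ [(\<not> b, r)], int (per b) * q) = (Q, int (per (\<not> b)) * q + int r)"
  by simp

declare move.simps [simp del]

lemma move_in_configs: "s \<in> configs \<Longrightarrow> move b s \<in> configs"
  by (erule move_cases[of s b]) (auto simp: configs_def reduced_snoc)

text \<open>Pushing and cancelling a syllable undo each other. The shift by a multiple of the period gives the
  cancellation \<open>t\<^sup>\<plusminus>\<^sup>1 t\<^sup>\<minusplus>\<^sup>1 = 1\<close> for \<open>k = 0\<close> and the defining relation for \<open>k = 1\<close>.\<close>

lemma move_inverse_shift:
  assumes "s \<in> configs"
  shows "move (\<not> b) (fst (move b s), snd (move b s) + int (per (\<not> b)) * k) =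
    (fst s, snd s + int (per b) * k)"
  using assms
proof (cases rule: move_cases[of s b])
  case (push Q r q)
  then show ?thesis
    using move_cancel[of "\<not> b" Q r "q + k"] by (simp add: distrib_left)
next
  case (cancel Q r q)
  then show ?thesis
    using move_push[of Q "\<not> b" r "q + k"] by (simp add: distrib_left add_ac)
qed

lemma act_in_configs: "s \<in> configs \<Longrightarrow> act x s \<in> configs"
proof -
  assume "s \<in> configs"
  moreover obtain g b where "x = (g, b)" by fastforce
  ultimately show ?thesis
    by (cases g; cases s) (auto simp: configs_def move_in_configs[unfolded configs_def])
qed

lemma fold_act_in_configs: "s \<in> configs \<Longrightarrow> fold act w s \<in> configs"
  by (induction w arbitrary: s) (simp_all add: act_in_configs)

lemma funpow_act_a:
  "(act (Gen_a, b) ^^ k) (Q, N) = (Q, N + int k * unit_of b)"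
  by (induction k arbitrary: N) (simp_all add: algebra_simps)

lemma fold_act_cancel:
  assumes "s \<in> configs"
  shows "fold act [(g, b), (g, \<not> b)] s = s"
proof (cases g)
  case Gen_a
  then show ?thesis
    by (cases s) (simp add: unit_of_def)
next
  case Gen_t
  then show ?thesis
    using move_inverse_shift[OF assms, of b 0] by simp
qed

lemma fold_act_rel:
  assumes "s \<in> configs"
  shows "fold act ([(Gen_t, True)] @ replicate m (Gen_a, True) @ [(Gen_t, False)]) s =
    fold act (replicate n (Gen_a, True)) s"
proof -
  obtain Q N where s: "s = (Q, N)" by fastforce
  obtain Q' N' where s': "move True s = (Q', N')" by fastforce
  have "move False (Q', N' + int m) = (Q, N + int n)"
    using move_inverse_shift[OF assms, of True 1] s' s by (simp add: per_def)
  then show ?thesis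
    using s' by (simp add: funpow_act_a s unit_of_def)
qed

text \<open>So the group acts on the configurations from the right. This is van der Waerden's way to show that
  normal forms are unique: two words for the same group element have the same effect on the trivial
  configuration, and that effect displays the normal form.\<close>

lemma fold_act_pres_eq:
  "pres_eq (BS_rels m n) u v \<Longrightarrow> s \<in> configs \<Longrightarrow> fold act u s = fold act v s"
proof (induction arbitrary: s rule: pres_eq.induct)
  case (cong u u' v v')
  then show ?case
    by (simp add: fold_act_in_configs)
next
  case (cancel g b)
  then show ?case
    using fold_act_cancel by simp
next
  case (rel u v)
  then show ?case
    using fold_act_rel by (simp add: BS_rels_def)
qed auto

text \<open>Acting on the trivial configuration with a normal form builds that normal form, since in
  a reduced product every syllable is pushed and none cancels.\<close>

lemma fold_act_encode:
  assumes "s \<in> configs"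
  shows "fold act (concat (map spell (encode s))) ([], 0) = s"
proof -
  obtain Q N where s: "s = (Q, N)" "reduced None Q"
    using assms by (auto simp: configs_def)
  have "fold act (concat (map spell (turns Q))) ([], 0) = (Q, 0)"
    using s(2)
  proof (induction Q rule: rev_induct)
    case (snoc x Q)
    obtain b r where x: "x = (b, r)" by fastforce
    show ?case
      using snoc move_push[of Q b r 0]
      by (simp add: x reduced_snoc funpow_act_a unit_of_def)
  qed simp
  moreover have "concat (map spell (steps N)) = replicate (nat \<bar>N\<bar>) (Gen_a, 0 \<le> N)"
    by (simp add: steps_def)
  ultimately show ?thesis
    by (simp add: s(1) funpow_act_a unit_of_def)
qed

subsection \<open>Values of normal forms in the group\<close>

abbreviation G where "G \<equiv> BS m n"

abbreviation cls where "cls \<equiv> pres_class (BS_rels m n)"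

definition eval :: "letter list \<Rightarrow> bs_gen word set" where
  "eval w = cls (concat (map spell w))"

sublocale group G
  by (rule group_BS)

lemma cls_mult: "cls u \<otimes>\<^bsub>G\<^esub> cls v = cls (u @ v)"
  by (simp add: BS_def pres_class_mult)

lemma cls_Nil: "cls [] = \<one>\<^bsub>G\<^esub>"
  by (simp add: BS_def one_presented_group)

lemma carrier_G: "carrier G = range cls"
  by (simp add: BS_def carrier_presented_group)

lemma cls_in_carrier [simp]: "cls u \<in> carrier G"
  by (simp add: carrier_G)

lemma eval_in_carrier [simp]: "eval u \<in> carrier G"
  by (simp add: eval_def)

lemma cls_inverse: "inv\<^bsub>G\<^esub> cls [(g, b)] = cls [(g, \<not> b)]"
proof (rule inv_equality)
  have "pres_eq (BS_rels m n) [(g, \<not> b), (g, b)] []"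
    using pres_eq.cancel[of _ g "\<not> b"] by simp
  then show "cls [(g, \<not> b)] \<otimes>\<^bsub>G\<^esub> cls [(g, b)] = \<one>\<^bsub>G\<^esub>"
    by (simp add: cls_mult flip: cls_Nil pres_class_eq_iff)
qed simp_all

definition \<alpha> where "\<alpha> = cls [(Gen_a, True)]"
definition \<tau> where "\<tau> b = cls [(Gen_t, b)]"

lemma \<alpha>_in_carrier [simp]: "\<alpha> \<in> carrier G"
  and \<tau>_in_carrier [simp]: "\<tau> b \<in> carrier G"
  by (simp_all add: \<alpha>_def \<tau>_def)

lemma \<tau>_cancel: "\<tau> (\<not> b) \<otimes>\<^bsub>G\<^esub> \<tau> b = \<one>\<^bsub>G\<^esub>"
  using cls_inverse[of Gen_t b] l_inv[of "\<tau> b"] by (simp add: \<tau>_def)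

lemma cls_replicate_a:
  "cls (replicate k (Gen_a, b)) = \<alpha> [^]\<^bsub>G\<^esub> (int k * unit_of b)"
proof (induction k)
  case 0
  show ?case by (simp add: cls_Nil)
next
  case (Suc k)
  have "cls [(Gen_a, b)] = \<alpha> [^]\<^bsub>G\<^esub> unit_of b"
    using cls_inverse[of Gen_a True] by (cases b) (simp_all add: unit_of_def \<alpha>_def int_pow_neg)
  then show ?case
    using cls_mult[of "[(Gen_a, b)]" "replicate k (Gen_a, b)"]
    by (simp add: Suc.IH int_pow_mult distrib_right)
qed

lemma \<alpha>_\<tau>_slide:
  "\<alpha> [^]\<^bsub>G\<^esub> (int (per b) * q) \<otimes>\<^bsub>G\<^esub> \<tau> b = \<tau> b \<otimes>\<^bsub>G\<^esub> \<alpha> [^]\<^bsub>G\<^esub> (int (per (\<not> b)) * q)"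
proof -
  have pow: "cls (replicate k (Gen_a, True)) = \<alpha> [^]\<^bsub>G\<^esub> int k" for k
    by (simp add: cls_replicate_a unit_of_def)
  have "pres_eq (BS_rels m n) ([(Gen_t, True)] @ replicate m (Gen_a, True) @ [(Gen_t, False)])
      (replicate n (Gen_a, True))"
    by (rule pres_eq.rel) (simp add: BS_rels_def)
  then have rel: "\<tau> True \<otimes>\<^bsub>G\<^esub> (\<alpha> [^]\<^bsub>G\<^esub> int m \<otimes>\<^bsub>G\<^esub> \<tau> False) = \<alpha> [^]\<^bsub>G\<^esub> int n"
    unfolding \<tau>_def pow[symmetric] cls_mult by (simp add: pres_class_eq_iff)
  have "\<alpha> [^]\<^bsub>G\<^esub> int (per b) \<otimes>\<^bsub>G\<^esub> \<tau> b = \<tau> b \<otimes>\<^bsub>G\<^esub> \<alpha> [^]\<^bsub>G\<^esub> int (per (\<not> b))"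
  proof (cases b)
    case True
    have "\<alpha> [^]\<^bsub>G\<^esub> int n \<otimes>\<^bsub>G\<^esub> \<tau> True = \<tau> True \<otimes>\<^bsub>G\<^esub> \<alpha> [^]\<^bsub>G\<^esub> int m"
      using \<tau>_cancel[of True] by (simp add: m_assoc flip: rel)
    then show ?thesis
      using True by (simp add: per_def)
  next
    case False
    have "\<tau> False \<otimes>\<^bsub>G\<^esub> \<alpha> [^]\<^bsub>G\<^esub> int n = \<alpha> [^]\<^bsub>G\<^esub> int m \<otimes>\<^bsub>G\<^esub> \<tau> False"
      using \<tau>_cancel[of True] by (simp flip: rel m_assoc)
    then show ?thesis
      using False by (simp add: per_def)
  qed
  from int_pow_slide[OF _ _ _ this, of q] show ?thesis
    by (simp add: int_pow_pow)
qed

lemma eval_append: "eval (u @ v) = eval u \<otimes>\<^bsub>G\<^esub> eval v"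
  by (simp add: eval_def cls_mult)

lemma eval_steps: "eval (steps N) = \<alpha> [^]\<^bsub>G\<^esub> N"
proof -
  have "eval (steps N) = cls (replicate (nat \<bar>N\<bar>) (Gen_a, 0 \<le> N))"
    by (simp add: eval_def steps_def)
  then show ?thesis
    by (simp add: cls_replicate_a unit_of_def)
qed

lemma eval_Turn: "eval [Turn b r] = \<alpha> [^]\<^bsub>G\<^esub> int r \<otimes>\<^bsub>G\<^esub> \<tau> b"
  by (simp add: eval_def \<tau>_def flip: cls_mult) (simp add: cls_replicate_a unit_of_def)

lemma eval_encode_snoc:
  "eval (encode (Q @ [(b, r)], int (per (\<not> b)) * q)) = eval (encode (Q, int (per b) * q + int r)) \<otimes>\<^bsub>G\<^esub> \<tau> b"
proof -
  have "\<alpha> [^]\<^bsub>G\<^esub> int r \<otimes>\<^bsub>G\<^esub> \<tau> b \<otimes>\<^bsub>G\<^esub> \<alpha> [^]\<^bsub>G\<^esub> (int (per (\<not> b)) * q) =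
      \<alpha> [^]\<^bsub>G\<^esub> (int r + int (per b) * q) \<otimes>\<^bsub>G\<^esub> \<tau> b"
    by (simp add: m_assoc int_pow_mult flip: \<alpha>_\<tau>_slide)
  then show ?thesis
    using eval_append[of "[Turn b r]" "steps (int (per (\<not> b)) * q)"]
    by (simp add: eval_append[of "turns Q"] eval_steps eval_Turn m_assoc add.commute)
qed

text \<open>The action on configurations is right multiplication in the group. Only cancelling needs an
  argument besides \<open>eval_encode_snoc\<close>: it is a push by the inverse letter, read backwards.\<close>

lemma eval_encode_act:
  assumes "s \<in> configs"
  shows "eval (encode (act x s)) = eval (encode s) \<otimes>\<^bsub>G\<^esub> cls [x]"
proof -
  obtain g b where x: "x = (g, b)" by fastforce
  show ?thesis
  proof (cases g)
    case Gen_a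
    obtain Q N where s: "s = (Q, N)" by fastforce
    show ?thesis
      using cls_replicate_a[of 1 b] by (simp add: x Gen_a s eval_append eval_steps int_pow_mult m_assoc)
  next
    case Gen_t
    from assms show ?thesis
    proof (cases rule: move_cases[of s b])
      case (push Q r q)
      then show ?thesis
        by (simp add: x Gen_t eval_encode_snoc \<tau>_def del: encode.simps)
    next
      case (cancel Q r q)
      have "eval (encode s) \<otimes>\<^bsub>G\<^esub> \<tau> b = eval (encode (move b s)) \<otimes>\<^bsub>G\<^esub> (\<tau> (\<not> b) \<otimes>\<^bsub>G\<^esub> \<tau> b)"
        using eval_encode_snoc[of Q "\<not> b" r q] cancel
        by (simp add: m_assoc del: encode.simps)
      then show ?thesis
        by (simp add: x Gen_t \<tau>_cancel \<tau>_def[symmetric] del: encode.simps)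
    qed
  qed
qed

lemma eval_encode_fold_act:
  "s \<in> configs \<Longrightarrow> eval (encode (fold act w s)) = eval (encode s) \<otimes>\<^bsub>G\<^esub> cls w"
proof (induction w arbitrary: s)
  case Nil
  then show ?case by (simp add: cls_Nil)
next
  case (Cons x w)
  then show ?case
    using cls_mult[of "[x]" w] by (simp add: act_in_configs eval_encode_act m_assoc)
qed

text \<open>Surjectivity: acting with a word on the trivial configuration produces a normal form of that word.
  Injectivity: equal group elements act equally, and the action of a normal form on the trivial
  configuration returns the normal form.\<close>

lemma bij_betw_eval: "bij_betw eval (encode ` configs) (carrier G)"
  unfolding bij_betw_def
proof
  have base: "([], 0) \<in> configs"
    by (simp add: configs_def)
  show "inj_on eval (encode ` configs)"
  proof (rule inj_onI)
    fix u v assume "u \<in> encode ` configs" "v \<in> encode ` configs" and eq: "eval u = eval v"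
    then obtain s s' where s: "u = encode s" "s \<in> configs" "v = encode s'" "s' \<in> configs"
      by auto
    have "pres_eq (BS_rels m n) (concat (map spell u)) (concat (map spell v))"
      using eq by (simp add: eval_def pres_class_eq_iff)
    from fold_act_pres_eq[OF this base] show "u = v"
      using fold_act_encode s by simp
  qed
  have "cls w \<in> eval ` encode ` configs" for w
  proof -
    have "eval (encode (fold act w ([], 0))) = cls w"
      using eval_encode_fold_act[OF base, of w] by (simp add: eval_def cls_Nil)
    then show ?thesis
      using fold_act_in_configs[OF base, of w] by (metis imageI)
  qed
  then show "eval ` encode ` configs = carrier G"
    by (auto simp: carrier_G eval_def)
qed

lemma multiplication_language:
  "{convolution u v | u v. u \<in> encode ` configs \<and> v \<in> encode ` configs \<and> eval v = eval u \<otimes>\<^bsub>G\<^esub> cls [x]} =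
    {convolution u v | u v. (u, v) \<in> (\<lambda>s. (encode s, encode (act x s))) ` configs}"
proof -
  have "u \<in> encode ` configs \<and> v \<in> encode ` configs \<and> eval v = eval u \<otimes>\<^bsub>G\<^esub> cls [x] \<longleftrightarrow>
    (u, v) \<in> (\<lambda>s. (encode s, encode (act x s))) ` configs" (is "?L \<longleftrightarrow> ?R") for u v
  proof
    assume ?L
    then obtain s where s: "u = encode s" "s \<in> configs" by blast
    have "eval v = eval (encode (act x s))"
      using \<open>?L\<close> s by (simp add: eval_encode_act)
    then have "v = encode (act x s)"
      using bij_betw_imp_inj_on[OF bij_betw_eval] \<open>?L\<close> s(2) act_in_configs
      by (metis image_eqI inj_onD)
    with s show ?R by blast
  next
    assume ?R
    then obtain s where "s \<in> configs" "u = encode s" "v = encode (act x s)"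
      by blast
    then show ?L
      by (simp only: eval_encode_act act_in_configs imageI)
  qed
  then show ?thesis by simp
qed

lemma BS_gens_eq: "BS_gens m n = range (\<lambda>x. cls [x])"
proof -
  have "UNIV = {(Gen_a, True), (Gen_a, False), (Gen_t, True), (Gen_t, False)}"
    using bs_gen.exhaust by auto
  from arg_cong[OF this, of "\<lambda>A. (\<lambda>x. cls [x]) ` A"] show ?thesis
    by (simp only: BS_gens_def BS_a_def BS_t_def cls_inverse image_insert image_empty HOL.simp_thms)
qed

lemma generate_BS_gens: "generate G (BS_gens m n) = carrier G"
proof
  show "generate G (BS_gens m n) \<subseteq> carrier G"
    by (rule generate_incl) (auto simp: BS_gens_eq)
  have "cls w \<in> generate G (BS_gens m n)" for w
  proof (induction w)
    case Nil
    show ?case by (simp add: cls_Nil generate.one)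
  next
    case (Cons x w)
    have "cls [x] \<in> generate G (BS_gens m n)"
      by (rule generate.incl) (auto simp: BS_gens_eq)
    from generate.eng[OF this Cons.IH] show ?case
      by (simp add: cls_mult)
  qed
  then show "carrier G \<subseteq> generate G (BS_gens m n)"
    by (auto simp: carrier_G)
qed

end

section \<open>Automata\<close>

text \<open>What a single track may still contain: syllables and then a unary number (\<open>Turning\<close>, with the
  sign of the last syllable), a unary number (\<open>Fresh\<close>), the rest of a unary number of known sign
  (\<open>Signed\<close>), or padding only (\<open>Ended\<close>).\<close>

datatype phase = Turning "bool option" | Fresh | Signed bool | Ended

instance phase :: finite
proof
  have "f \<in> range Turning \<union> {Fresh, Ended} \<union> range Signed" for f
    by (cases f) simp_all
  then have "(UNIV :: phase set) \<subseteq> range Turning \<union> {Fresh, Ended} \<union> range Signed"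
    by (rule subsetI)
  then show "finite (UNIV :: phase set)"
    by (rule finite_subset) simp
qed

definition val :: "letter list \<Rightarrow> int" where
  "val w = (\<Sum>x\<leftarrow>w. case x of Step b \<Rightarrow> unit_of b | Turn _ _ \<Rightarrow> 0)"

lemma val_append: "val (u @ v) = val u + val v"
  by (simp add: val_def)

lemma val_steps [simp]: "val (steps N) = N"
  by (simp add: val_def steps_def unit_of_def map_replicate_const sum_list_replicate)

lemma range_steps_iff: "u \<in> range steps \<longleftrightarrow> u = steps (val u)"
  by auto

lemma steps_eq_Cons_iff:
  "Step c # w \<in> range steps \<longleftrightarrow> (\<exists>k. w = replicate k (Step c))"
proof
  assume "Step c # w \<in> range steps"
  then obtain N where N: "Step c # w = replicate (nat \<bar>N\<bar>) (Step (0 \<le> N))"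
    by (auto simp: steps_def)
  then obtain k where "nat \<bar>N\<bar> = Suc k"
    by (cases "nat \<bar>N\<bar>") auto
  with N show "\<exists>k. w = replicate k (Step c)"
    by auto
next
  assume "\<exists>k. w = replicate k (Step c)"
  then obtain k where "w = replicate k (Step c)" ..
  then have "Step c # w = steps (unit_of c * int (Suc k))"
    by (simp add: steps_def unit_of_def nat_add_distrib)
  then show "Step c # w \<in> range steps"
    by (rule range_eqI)
qed

lemma steps_neq_Turn_Cons [simp]: "steps N \<noteq> Turn b r # w" "Turn b r # w \<noteq> steps N"
proof -
  show "steps N \<noteq> Turn b r # w"
    by (cases "nat \<bar>N\<bar>") (auto simp: steps_def)
  then show "Turn b r # w \<noteq> steps N"
    by metis
qed

lemma turns_steps_eq_Turn:
  "turns Q @ steps N = Turn b r # w \<longleftrightarrow> (\<exists>Q'. Q = (b, r) # Q' \<and> turns Q' @ steps N = w)"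
  by (cases Q) (auto split: prod.splits)

lemma steps_snoc:
  assumes "steps N = v @ [Step b]"
  shows "v = steps (N - unit_of b)"
proof -
  have "v @ [Step b] = replicate (nat \<bar>N\<bar>) (Step (0 \<le> N))"
    using assms by (simp add: steps_def)
  moreover from this obtain k where k: "nat \<bar>N\<bar> = Suc k"
    by (cases "nat \<bar>N\<bar>") auto
  ultimately have "v = replicate k (Step b)" "b \<longleftrightarrow> 0 \<le> N"
    by (auto simp: replicate_append_same[symmetric])
  moreover have "nat \<bar>N - unit_of b\<bar> = k" "k \<noteq> 0 \<Longrightarrow> 0 \<le> N - unit_of b \<longleftrightarrow> b"
    using k \<open>b \<longleftrightarrow> 0 \<le> N\<close> by (auto simp: unit_of_def)
  ultimately show ?thesis
    by (cases "k = 0") (simp_all add: steps_def)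
qed

lemma steps_add_unit:
  "steps (N + unit_of b) = steps N @ [Step b] \<or> steps N = steps (N + unit_of b) @ [Step (\<not> b)]"
proof (cases "N = 0 \<or> (0 \<le> N \<longleftrightarrow> b)")
  case True
  then have "nat \<bar>N + unit_of b\<bar> = Suc (nat \<bar>N\<bar>)" "0 \<le> N + unit_of b \<longleftrightarrow> b"
    by (auto simp: unit_of_def)
  then show ?thesis
    using True by (auto simp: steps_def replicate_append_same)
next
  case False
  then have "nat \<bar>N\<bar> = Suc (nat \<bar>N + unit_of b\<bar>)" "N + unit_of b \<noteq> 0 \<Longrightarrow> 0 \<le> N + unit_of b \<longleftrightarrow> \<not> b"
    by (auto simp: unit_of_def)
  then show ?thesis
    using False by (cases "N + unit_of b = 0") (auto simp: steps_def replicate_append_same)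
qed

context baumslag_solitar
begin

definition letters :: "letter set" where
  "letters = (\<Union>b. Turn b ` {..<per b}) \<union> range Step"

lemma finite_letters: "finite letters"
  by (simp add: letters_def)

fun phase_words :: "phase \<Rightarrow> letter list set" where
  "phase_words (Turning p) = encode ` ({Q. reduced p Q} \<times> UNIV)"
| "phase_words Fresh = range steps"
| "phase_words (Signed c) = {replicate k (Step c) | k. True}"
| "phase_words Ended = {[]}"

fun advance :: "phase \<Rightarrow> letter option \<Rightarrow> phase option" where
  "advance (Turning p) (Some (Turn b r)) = (if reduced p [(b, r)] then Some (Turning (Some b)) else None)"
| "advance (Turning p) (Some (Step c)) = Some (Signed c)"
| "advance Fresh (Some (Step c)) = Some (Signed c)"
| "advance (Signed c') (Some (Step c)) = (if c = c' then Some (Signed c) else None)"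
| "advance f None = Some Ended"
| "advance f y = None"

lemma encode_configs: "encode ` configs = phase_words (Turning None)"
  by (simp add: configs_def)

lemma phase_words_Turning_iff:
  "w \<in> phase_words (Turning p) \<longleftrightarrow> (\<exists>Q N. reduced p Q \<and> turns Q @ steps N = w)"
  unfolding phase_words.simps image_iff by force

lemma turns_steps_in_phase_words:
  "reduced p Q \<Longrightarrow> turns Q @ steps N \<in> phase_words (Turning p)"
  unfolding phase_words_Turning_iff by blast

lemma turns_in_letters: "reduced p Q \<Longrightarrow> set (turns Q) \<subseteq> letters"
  by (induction p Q rule: reduced.induct) (auto simp: letters_def)

lemma steps_in_letters: "set (steps N) \<subseteq> letters"
  by (auto simp: steps_def letters_def)

lemma phase_words_letters: "phase_words f \<subseteq> lists letters"
proof (cases f)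
  case (Turning p)
  then show ?thesis
    using turns_in_letters[of p] steps_in_letters by fastforce
next
  case Fresh
  then show ?thesis
    using steps_in_letters by auto
qed (auto simp: letters_def)

lemma Nil_in_phase_words [simp]: "[] \<in> phase_words f"
proof (cases f)
  case (Turning p)
  then show ?thesis
    by (auto intro!: image_eqI[of _ _ "([], 0)"])
next
  case Fresh
  then show ?thesis
    by (auto intro!: image_eqI[of _ _ 0])
qed auto

lemma Turn_Cons_in_phase_words:
  "Turn b r # w \<in> phase_words f \<longleftrightarrow> (\<exists>g. advance f (Some (Turn b r)) = Some g \<and> w \<in> phase_words g)"
proof (cases f)
  case (Turning p)
  have "Turn b r # w \<in> phase_words f \<longleftrightarrow> (\<exists>Q N. reduced p Q \<and> turns Q @ steps N = Turn b r # w)"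
    unfolding Turning phase_words_Turning_iff ..
  also have "\<dots> \<longleftrightarrow> reduced p [(b, r)] \<and> (\<exists>Q N. reduced (Some b) Q \<and> turns Q @ steps N = w)"
  proof
    assume "\<exists>Q N. reduced p Q \<and> turns Q @ steps N = Turn b r # w"
    then show "reduced p [(b, r)] \<and> (\<exists>Q N. reduced (Some b) Q \<and> turns Q @ steps N = w)"
      unfolding turns_steps_eq_Turn by auto
  next
    assume "reduced p [(b, r)] \<and> (\<exists>Q N. reduced (Some b) Q \<and> turns Q @ steps N = w)"
    then obtain Q N where "reduced p [(b, r)]" "reduced (Some b) Q" "turns Q @ steps N = w"
      by blast
    then show "\<exists>Q N. reduced p Q \<and> turns Q @ steps N = Turn b r # w"
      by (intro exI[of _ "(b, r) # Q"] exI[of _ N]) auto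
  qed
  also have "\<dots> \<longleftrightarrow> reduced p [(b, r)] \<and> w \<in> phase_words (Turning (Some b))"
    unfolding phase_words_Turning_iff ..
  finally show ?thesis
    by (simp add: Turning del: phase_words.simps reduced.simps)
qed (auto simp: Cons_replicate_eq)

lemma Step_Cons_in_phase_words:
  "Step c # w \<in> phase_words f \<longleftrightarrow> (\<exists>g. advance f (Some (Step c)) = Some g \<and> w \<in> phase_words g)"
proof (cases f)
  case (Turning p)
  have "Step c # w = turns Q @ steps N \<longleftrightarrow> Q = [] \<and> Step c # w = steps N" for Q N
    by (cases Q) (auto split: prod.splits)
  then have "Step c # w \<in> phase_words f \<longleftrightarrow> Step c # w \<in> range steps"
    by (auto simp: Turning image_iff intro!: exI[of _ "[]"])
  then show ?thesis
    by (simp add: Turning steps_eq_Cons_iff)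
next
  case Fresh
  then show ?thesis
    by (simp add: steps_eq_Cons_iff)
next
  case (Signed c')
  then show ?thesis
    by (auto simp: Cons_replicate_eq gr0_conv_Suc) 
qed simp

text \<open>The transitions of a single track, from which those of all the automata below are built. The
  symbol \<open>None\<close> is padding, so it leaves nothing to be read.\<close>

lemma phase_words_advance:
  "(y = None \<longrightarrow> w = []) \<and> opt_list y @ w \<in> phase_words f \<longleftrightarrow>
    (\<exists>g. advance f y = Some g \<and> w \<in> phase_words g)"
proof (cases y)
  case None
  then show ?thesis
    using Nil_in_phase_words[of f] by (cases f) (auto simp del: Nil_in_phase_words)
next
  case (Some x)
  then show ?thesis
    by (cases x) (simp_all add: Turn_Cons_in_phase_words Step_Cons_in_phase_words)
qed

subsection \<open>The language of normal forms\<close>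

lemma normal_forms_regular:
  assumes "0 < k"
  shows "encode ` configs \<in> blind_counter_languages k"
proof -
  define K where "K = (\<lambda>f (c :: int). if c = 0 then phase_words f else {})"
  have "K (Turning None) 0 \<in> blind_counter_languages k"
  proof (rule blind_counter_languageI_residuals[where S = UNIV and K = K and \<Sigma> = letters, OF assms])
    show "K f c \<subseteq> lists letters" for f c
      using phase_words_letters by (simp add: K_def)
    show "(\<forall>c w. x # w \<notin> K f c) \<or> (\<exists>g\<in>UNIV. \<exists>e. \<forall>c w. x # w \<in> K f c \<longleftrightarrow> w \<in> K g (c + e))" for f x
    proof (cases "advance f (Some x)")
      case None
      then show ?thesis
        using phase_words_advance[of "Some x" _ f] by (simp add: K_def)
    next
      case (Some g)
      then have "\<forall>c w. x # w \<in> K f c \<longleftrightarrow> w \<in> K g (c + 0)"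
        using phase_words_advance[of "Some x" _ f] by (simp add: K_def)
      then show ?thesis by blast
    qed
  qed (simp_all add: K_def finite_letters)
  then show ?thesis
    by (simp add: K_def encode_configs)
qed

subsection \<open>Multiplication by \<open>a\<close>\<close>

text \<open>Two normal forms that differ by \<open>a\<^sup>\<plusminus>\<^sup>1\<close> differ by one final letter, so both tracks are read in the
  same phase until one of them ends. The phase \<open>None\<close> is entered after that last letter.\<close>

fun step_residual :: "bool \<Rightarrow> phase option \<Rightarrow> (letter list \<times> letter list) set" where
  "step_residual b (Some f) =
    {(w, w @ [Step b]) | w. w @ [Step b] \<in> phase_words f} \<union>
    {(w @ [Step (\<not> b)], w) | w. w @ [Step (\<not> b)] \<in> phase_words f}"
| "step_residual b None = {([], [])}"

lemma step_relation:
  "(\<lambda>s. (encode s, encode (act (Gen_a, b) s))) ` configs = step_residual b (Some (Turning None))"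
    (is "?A = ?B")
proof
  show "?A \<subseteq> ?B"
  proof
    fix x assume "x \<in> ?A"
    then obtain Q N where x: "x = (turns Q @ steps N, turns Q @ steps (N + unit_of b))" and Q: "reduced None Q"
      by (auto simp: configs_def)
    have w: "turns Q @ steps M \<in> phase_words (Turning None)" for M
      using Q by (rule turns_steps_in_phase_words)
    from steps_add_unit[of N b] show "x \<in> ?B"
    proof
      assume "steps (N + unit_of b) = steps N @ [Step b]"
      then show ?thesis
        using w[of "N + unit_of b"] by (simp add: x)
    next
      assume "steps N = steps (N + unit_of b) @ [Step (\<not> b)]"
      then show ?thesis
        using w[of N] by (simp add: x)
    qed
  qed
  have split: "\<exists>Q M. reduced None Q \<and> w = turns Q @ steps (M - unit_of c) \<and> w @ [Step c] = turns Q @ steps M"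
    if w: "w @ [Step c] \<in> phase_words (Turning None)" for w c
  proof -
    obtain Q M where Q: "reduced None Q" "turns Q @ steps M = w @ [Step c]"
      using w unfolding phase_words_Turning_iff by blast
    obtain v where v: "steps M = v @ [Step c]"
    proof (cases "steps M" rule: rev_cases)
      case Nil
      then have "Step c \<in> set (turns Q)"
        using Q by (metis append_Nil2 in_set_conv_decomp)
      then show ?thesis
        by (auto simp: turns_def)
    qed (use Q in auto)
    show ?thesis
      using Q steps_snoc[OF v] v by (intro exI[of _ Q] exI[of _ M]) auto
  qed
  show "?B \<subseteq> ?A"
  proof
    fix x assume "x \<in> ?B"
    then consider w where "x = (w, w @ [Step b])" "w @ [Step b] \<in> phase_words (Turning None)"
      | w where "x = (w @ [Step (\<not> b)], w)" "w @ [Step (\<not> b)] \<in> phase_words (Turning None)"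
      by auto
    then show "x \<in> ?A"
    proof cases
      case 1
      from split[OF 1(2)] obtain Q M where "reduced None Q" "w = turns Q @ steps (M - unit_of b)"
        "w @ [Step b] = turns Q @ steps M" by blast
      then show ?thesis
        using 1 by (intro image_eqI[of _ _ "(Q, M - unit_of b)"]) (simp_all add: configs_def)
    next
      case 2
      from split[OF 2(2)] obtain Q M where "reduced None Q" "w = turns Q @ steps (M - unit_of (\<not> b))"
        "w @ [Step (\<not> b)] = turns Q @ steps M" by blast
      then show ?thesis
        using 2 by (intro image_eqI[of _ _ "(Q, M)"]) (simp_all add: configs_def unit_of_def)
    qed
  qed
qed

lemma step_language_regular:
  assumes "0 < k"
  shows "{convolution u v | u v. (u, v) \<in> (\<lambda>s. (encode s, encode (act (Gen_a, b) s))) ` configs}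
    \<in> blind_counter_languages k"
proof -
  define R where "R = (\<lambda>q (c :: int). if c = 0 then step_residual b q else {})"
  have "{convolution u v | u v. (u, v) \<in> R (Some (Turning None)) 0} \<in> blind_counter_languages k"
  proof (rule blind_counter_convolutionI_residuals[where S = UNIV and R = R and \<Lambda> = letters, OF assms])
    show "R q c \<subseteq> lists letters \<times> lists letters" for q c
    proof -
      have pw: "set w \<subseteq> letters \<and> x \<in> letters" if "w @ [x] \<in> phase_words f" for w x f
        using subsetD[OF phase_words_letters that] by auto
      show ?thesis
      proof (cases q)
        case None
        then show ?thesis by (simp add: R_def)
      next
        case (Some f)
        have "u \<in> lists letters \<and> v \<in> lists letters" if "(u, v) \<in> step_residual b (Some f)" for u v
          using that pw[of u "Step b" f] pw[of v "Step (\<not> b)" f] by auto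
        then show ?thesis
          unfolding R_def Some by auto
      qed
    qed
    show "(\<forall>c u v. (y = None \<longrightarrow> u = []) \<longrightarrow> (z = None \<longrightarrow> v = []) \<longrightarrow> (opt_list y @ u, opt_list z @ v) \<notin> R q c) \<or>
      (\<exists>q'\<in>UNIV. \<exists>e. \<forall>c u v.
        (y = None \<longrightarrow> u = []) \<and> (z = None \<longrightarrow> v = []) \<and> (opt_list y @ u, opt_list z @ v) \<in> R q c \<longleftrightarrow>
        (u, v) \<in> R q' (c + e))" (is "?dead \<or> ?live")
      if yz: "y \<noteq> None \<or> z \<noteq> None" for q y z
    proof (cases q)
      case None
      then show ?thesis
        using yz by (auto simp: R_def)
    next
      case (Some f)
      have adv: "x # w \<in> phase_words f \<longleftrightarrow> (\<exists>g. advance f (Some x) = Some g \<and> w \<in> phase_words g)" for x w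
        using phase_words_advance[of "Some x" w f] by simp
      have mem: "(u, v) \<in> step_residual b (Some f) \<longleftrightarrow>
          (v = u @ [Step b] \<and> v \<in> phase_words f) \<or> (u = v @ [Step (\<not> b)] \<and> u \<in> phase_words f)" for u v f
        by auto
      consider (both) x x' where "y = Some x" "z = Some x'"
        | (left) x where "y = Some x" "z = None" | (right) x where "y = None" "z = Some x"
        using yz by (cases y; cases z) auto
      then show ?thesis
      proof cases
        case both
        show ?thesis
        proof (cases "x = x' \<and> advance f (Some x) \<noteq> None")
          case True
          then obtain g where g: "advance f (Some x) = Some g" by auto
          have "\<forall>c u v. (y = None \<longrightarrow> u = []) \<and> (z = None \<longrightarrow> v = []) \<and> (opt_list y @ u, opt_list z @ v) \<in> R q c \<longleftrightarrow>
              (u, v) \<in> R (Some g) (c + 0)"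
            using True both g by (simp add: R_def Some mem adv del: step_residual.simps)
          then show ?thesis by blast
        next
          case False
          then have ?dead
            using both by (auto simp: R_def Some mem adv simp del: step_residual.simps)
          then show ?thesis ..
        qed
      next
        case left
        show ?thesis
        proof (cases "x = Step (\<not> b) \<and> advance f (Some x) \<noteq> None")
          case True
          have "\<forall>c u v. (y = None \<longrightarrow> u = []) \<and> (z = None \<longrightarrow> v = []) \<and> (opt_list y @ u, opt_list z @ v) \<in> R q c \<longleftrightarrow>
              (u, v) \<in> R None (c + 0)"
            using True left by (auto simp: R_def Some mem adv simp del: step_residual.simps(1))
          then show ?thesis by blast
        next
          case False
          then have ?dead
            using left by (auto simp: R_def Some mem adv simp del: step_residual.simps)
          then show ?thesis ..
        qed
      next
        case right
        show ?thesis
        proof (cases "x = Step b \<and> advance f (Some x) \<noteq> None")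
          case True
          have "\<forall>c u v. (y = None \<longrightarrow> u = []) \<and> (z = None \<longrightarrow> v = []) \<and> (opt_list y @ u, opt_list z @ v) \<in> R q c \<longleftrightarrow>
              (u, v) \<in> R None (c + 0)"
            using True right by (auto simp: R_def Some mem adv simp del: step_residual.simps(1))
          then show ?thesis by blast
        next
          case False
          then have ?dead
            using right by (auto simp: R_def Some mem adv simp del: step_residual.simps)
          then show ?thesis ..
        qed
      qed
    qed
  qed (simp_all add: R_def finite_letters)
  then show ?thesis
    by (simp only: R_def step_relation if_True HOL.simp_thms)
qed

subsection \<open>Multiplication by \<open>t\<close>\<close>

text \<open>The words \<open>u\<close> and \<open>v\<close> share their syllables except for one more syllable \<open>x\<close> at the end of those of
  \<open>v\<close>; the condition \<open>A\<close> relates that syllable and the unary tails. Multiplication by \<open>t\<^sup>\<plusminus>\<^sup>1\<close> is of this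
  shape when it pushes, and the converse of such a relation when it cancels.\<close>

definition diverging ::
  "(bool \<times> nat \<Rightarrow> int \<Rightarrow> int \<Rightarrow> bool) \<Rightarrow> bool option \<Rightarrow> letter list \<Rightarrow> letter list \<Rightarrow> bool" where
  "diverging A p u v \<longleftrightarrow> (\<exists>Q x N N'. reduced p (Q @ [x]) \<and>
    u = turns Q @ steps N \<and> v = turns (Q @ [x]) @ steps N' \<and> A x N N')"

lemma diverging_Turn_Turn:
  "diverging A p (Turn e r # u) (Turn e' r' # v) \<longleftrightarrow>
    e = e' \<and> r = r' \<and> reduced p [(e, r)] \<and> diverging A (Some e) u v"
proof
  assume "diverging A p (Turn e r # u) (Turn e' r' # v)"
  then obtain Q x N N' where *: "reduced p (Q @ [x])" "turns Q @ steps N = Turn e r # u"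
      "turns (Q @ [x]) @ steps N' = Turn e' r' # v" "A x N N'"
    unfolding diverging_def by metis
  then obtain Q' where "Q = (e, r) # Q'" "turns Q' @ steps N = u"
    unfolding turns_steps_eq_Turn by blast
  then have "turns (Q' @ [x]) @ steps N' = v" "e = e'" "r = r'" "reduced p [(e, r)]" "reduced (Some e) (Q' @ [x])"
    using *(1,3) by auto
  then show "e = e' \<and> r = r' \<and> reduced p [(e, r)] \<and> diverging A (Some e) u v"
    using *(4) \<open>turns Q' @ steps N = u\<close> unfolding diverging_def by blast
next
  assume *: "e = e' \<and> r = r' \<and> reduced p [(e, r)] \<and> diverging A (Some e) u v"
  then obtain Q x N N' where "reduced (Some e) (Q @ [x])" "u = turns Q @ steps N"
      "v = turns (Q @ [x]) @ steps N'" "A x N N'"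
    unfolding diverging_def by blast
  with * show "diverging A p (Turn e r # u) (Turn e' r' # v)"
    unfolding diverging_def by (intro exI[of _ "(e, r) # Q"] exI[of _ x] exI[of _ N] exI[of _ N']) auto
qed

lemma diverging_steps_Turn:
  assumes "\<And>e r w. u \<noteq> Turn e r # w"
  shows "diverging A p u (Turn e r # v) \<longleftrightarrow>
    reduced p [(e, r)] \<and> u \<in> range steps \<and> v \<in> range steps \<and> A (e, r) (val u) (val v)"
proof
  assume "diverging A p u (Turn e r # v)"
  then obtain Q x N N' where *: "reduced p (Q @ [x])" "u = turns Q @ steps N"
      "turns (Q @ [x]) @ steps N' = Turn e r # v" "A x N N'"
    unfolding diverging_def by metis
  moreover have "Q = []"
    using * assms by (cases Q) (auto split: prod.splits)
  ultimately show "reduced p [(e, r)] \<and> u \<in> range steps \<and> v \<in> range steps \<and> A (e, r) (val u) (val v)"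
    by (auto split: prod.splits)
next
  assume "reduced p [(e, r)] \<and> u \<in> range steps \<and> v \<in> range steps \<and> A (e, r) (val u) (val v)"
  then show "diverging A p u (Turn e r # v)"
    unfolding diverging_def range_steps_iff
    by (intro exI[of _ "[]"] exI[of _ "(e, r)"] exI[of _ "val u"] exI[of _ "val v"]) auto
qed

lemma diverging_longer:
  assumes "diverging A p u v"
  obtains e r w where "v = Turn e r # w"
proof -
  obtain Q x N' where "v = turns (Q @ [x]) @ steps N'"
    using assms unfolding diverging_def by blast
  then show ?thesis
    using that by (cases "Q @ [x]") (auto split: prod.splits)
qed

datatype move_state = Common "bool option" | Tail int phase phase

text \<open>In state \<open>Common p\<close> only equal syllables have been read, the last one with sign \<open>p\<close>. The two parts
  correspond to pushing, where \<open>N = d q + r\<close> and \<open>N' = d' q\<close>, and to cancelling, where \<open>N = d q\<close> and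
  \<open>N' = d' q + r\<close>. Elimination of \<open>q\<close> turns each into a divisibility and one linear equation. The
  extra syllable, once seen, decides between the parts, and from then on only these two conditions
  on the values of the tails remain: \<open>Tail\<close> keeps a residue modulo \<open>d\<close> for the divisibility, and the
  counter \<open>c\<close> has the defect of the equation. Both parts count \<open>d'\<close> for a unit of the first tail and
  \<open>- d\<close> for one of the second, so a single kind of tail state serves both.\<close>

fun move_residual :: "bool \<Rightarrow> move_state \<Rightarrow> int \<Rightarrow> (letter list \<times> letter list) set" where
  "move_residual b (Common p) c =
    {(u, v). diverging (\<lambda>(e, r) N N'. e = b \<and> int (per b) dvd N - int r \<and>
      c + int (per (\<not> b)) * (N - int r) = int (per b) * N') p u v} \<union>
    {(u, v). diverging (\<lambda>(e, r) N' N. e = (\<not> b) \<and> int (per b) dvd N \<and>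
      c + int (per (\<not> b)) * N = int (per b) * (N' - int r)) p v u}"
| "move_residual b (Tail \<rho> f f') c =
    {(u, v). u \<in> phase_words f \<and> v \<in> phase_words f' \<and> int (per b) dvd \<rho> + val u \<and>
      c + int (per (\<not> b)) * val u = int (per b) * val v}"

lemma move_relation:
  "(\<lambda>s. (encode s, encode (act (Gen_t, b) s))) ` configs = move_residual b (Common None) 0"
    (is "?A = ?B")
proof
  show "?A \<subseteq> ?B"
  proof
    fix x assume "x \<in> ?A"
    then obtain s where s: "s \<in> configs" and x: "x = (encode s, encode (move b s))"
      by auto
    from s show "x \<in> ?B"
    proof (cases rule: move_cases[of s b])
      case (push Q r q)
      have "diverging (\<lambda>(e, r) N N'. e = b \<and> int (per b) dvd N - int r \<and>
          0 + int (per (\<not> b)) * (N - int r) = int (per b) * N') None (encode s) (encode (move b s))"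
        unfolding diverging_def
        by (rule exI[of _ Q], rule exI[of _ "(b, r)"], rule exI[of _ "int (per b) * q + int r"],
            rule exI[of _ "int (per (\<not> b)) * q"])
          (use push in \<open>simp add: reduced_snoc\<close>)
      then show ?thesis
        unfolding x by simp
    next
      case (cancel Q r q)
      have "diverging (\<lambda>(e, r) N' N. e = (\<not> b) \<and> int (per b) dvd N \<and>
          0 + int (per (\<not> b)) * N = int (per b) * (N' - int r)) None (encode (move b s)) (encode s)"
        unfolding diverging_def
        by (rule exI[of _ Q], rule exI[of _ "(\<not> b, r)"], rule exI[of _ "int (per (\<not> b)) * q + int r"],
            rule exI[of _ "int (per b) * q"])
          (use cancel in \<open>simp add: reduced_snoc\<close>)
      then show ?thesis
        unfolding x by simp
    qed
  qed
  show "?B \<subseteq> ?A"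
  proof (rule subrelI)
    fix u v assume "(u, v) \<in> ?B"
    then consider (push) "diverging (\<lambda>(e, r) N N'. e = b \<and> int (per b) dvd N - int r \<and>
        0 + int (per (\<not> b)) * (N - int r) = int (per b) * N') None u v"
      | (cancel) "diverging (\<lambda>(e, r) N' N. e = (\<not> b) \<and> int (per b) dvd N \<and>
        0 + int (per (\<not> b)) * N = int (per b) * (N' - int r)) None v u"
      by (auto simp only: move_residual.simps Un_iff mem_Collect_eq prod.case)
    then show "(u, v) \<in> ?A"
    proof cases
      case push
      then obtain Q r N N' where *: "reduced None (Q @ [(b, r)])" "u = turns Q @ steps N"
          "v = turns (Q @ [(b, r)]) @ steps N'" "int (per b) dvd N - int r"
          "int (per (\<not> b)) * (N - int r) = int (per b) * N'"
        unfolding diverging_def by auto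
      from *(4) obtain q where q: "N = int (per b) * q + int r"
        by (metis diff_add_cancel dvdE)
      then have "N' = int (per (\<not> b)) * q"
        using *(5) by simp
      then have "(u, v) = (encode (Q, N), encode (act (Gen_t, b) (Q, N)))"
        using * by (simp add: q move_push)
      moreover have "(Q, N) \<in> configs"
        using *(1) by (simp add: configs_def reduced_snoc)
      ultimately show ?thesis
        by blast
    next
      case cancel
      then obtain Q r N N' where *: "reduced None (Q @ [(\<not> b, r)])" "v = turns Q @ steps N'"
          "u = turns (Q @ [(\<not> b, r)]) @ steps N" "int (per b) dvd N"
          "int (per (\<not> b)) * N = int (per b) * (N' - int r)"
        unfolding diverging_def by auto
      from *(4) obtain q where q: "N = int (per b) * q"
        by (elim dvdE)
      then have "N' = int (per (\<not> b)) * q + int r"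
        using *(5) by simp
      then have "(u, v) = (encode (Q @ [(\<not> b, r)], N), encode (act (Gen_t, b) (Q @ [(\<not> b, r)], N)))"
        using * by (simp add: q move_cancel)
      moreover have "(Q @ [(\<not> b, r)], N) \<in> configs"
        using *(1) by (simp add: configs_def)
      ultimately show ?thesis
        by blast
    qed
  qed
qed

definition move_states :: "bool \<Rightarrow> move_state set" where
  "move_states b = range Common \<union> (\<lambda>(\<rho>, f, f'). Tail \<rho> f f') ` ({0..<int (per b)} \<times> UNIV \<times> UNIV)"

lemma finite_move_states: "finite (move_states b)"
  by (simp add: move_states_def)

lemma Common_in_move_states [simp]: "Common p \<in> move_states b"
  by (simp add: move_states_def)

lemma Tail_in_move_states [simp]: "Tail (i mod int (per b)) f f' \<in> move_states b"
  by (auto simp: move_states_def image_iff intro!: bexI[of _ "(i mod int (per b), f, f')"])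

lemma Tail_0_in_move_states [simp]: "Tail 0 f f' \<in> move_states b"
  using Tail_in_move_states[of 0] by simp

lemma dvd_mod_add_val:
  "int (per b) dvd i mod int (per b) + j \<longleftrightarrow> int (per b) dvd i + j"
  by (simp add: dvd_eq_mod_eq_0 mod_add_left_eq)

lemma Tail_advance_left:
  assumes "advance f y = Some g"
  shows "(y = None \<longrightarrow> u = []) \<and> (opt_list y @ u, v) \<in> move_residual b (Tail \<rho> f f') c \<longleftrightarrow>
    (u, v) \<in> move_residual b (Tail ((\<rho> + val (opt_list y)) mod int (per b)) g f')
      (c + int (per (\<not> b)) * val (opt_list y))"
proof -
  have "u \<in> phase_words g \<longleftrightarrow> (y = None \<longrightarrow> u = []) \<and> opt_list y @ u \<in> phase_words f"
    using phase_words_advance[of y u f] assms by simp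
  moreover have "int (per b) dvd (\<rho> + val (opt_list y)) mod int (per b) + val u \<longleftrightarrow>
      int (per b) dvd \<rho> + val (opt_list y @ u)"
    by (simp add: dvd_mod_add_val val_append add.assoc)
  moreover have "c + int (per (\<not> b)) * val (opt_list y) + int (per (\<not> b)) * val u =
      c + int (per (\<not> b)) * val (opt_list y @ u)"
    by (simp add: val_append algebra_simps)
  ultimately show ?thesis
    unfolding move_residual.simps mem_Collect_eq prod.case by metis
qed

lemma Tail_advance_right:
  assumes "advance f' z = Some g'"
  shows "(z = None \<longrightarrow> v = []) \<and> (u, opt_list z @ v) \<in> move_residual b (Tail \<rho> f f') c \<longleftrightarrow>
    (u, v) \<in> move_residual b (Tail \<rho> f g') (c - int (per b) * val (opt_list z))"
proof -
  have "v \<in> phase_words g' \<longleftrightarrow> (z = None \<longrightarrow> v = []) \<and> opt_list z @ v \<in> phase_words f'"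
    using phase_words_advance[of z v f'] assms by simp
  moreover have "c - int (per b) * val (opt_list z) + int (per (\<not> b)) * val u = int (per b) * val v \<longleftrightarrow>
      c + int (per (\<not> b)) * val u = int (per b) * val (opt_list z @ v)"
    by (auto simp: val_append algebra_simps)
  ultimately show ?thesis
    unfolding move_residual.simps mem_Collect_eq prod.case by metis
qed

lemma Tail_stuck:
  assumes "advance f y = None \<or> advance f' z = None" "y = None \<longrightarrow> u = []" "z = None \<longrightarrow> v = []"
  shows "(opt_list y @ u, opt_list z @ v) \<notin> move_residual b (Tail \<rho> f f') c"
proof -
  have "\<not> (opt_list y @ u \<in> phase_words f \<and> opt_list z @ v \<in> phase_words f')"
    using phase_words_advance[of y u f] phase_words_advance[of z v f'] assms by auto
  then show ?thesis
    unfolding move_residual.simps mem_Collect_eq prod.case by blast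
qed

text \<open>The transitions from \<open>Common\<close>. Two syllables must agree. A syllable facing no syllable is the extra
  one, and its exponent \<open>r\<close> enters the two conditions as a constant: when pushing, the residue starts
  at \<open>- r\<close> and the counter at \<open>- d' r\<close>, and when cancelling, at \<open>0\<close> and \<open>d r\<close>.\<close>

lemma Common_Turn_Turn:
  "(Turn e r # u, Turn e' r' # v) \<in> move_residual b (Common p) c \<longleftrightarrow>
    e = e' \<and> r = r' \<and> reduced p [(e, r)] \<and> (u, v) \<in> move_residual b (Common (Some e)) c"
  by (auto simp add: diverging_Turn_Turn simp del: reduced.simps)

lemma Common_steps_Turn:
  assumes u: "\<And>e r w. u \<noteq> Turn e r # w"
  shows "(u, Turn e r # v) \<in> move_residual b (Common p) c \<longleftrightarrow>
    e = b \<and> reduced p [(b, r)] \<and>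
    (u, v) \<in> move_residual b (Tail ((- int r) mod int (per b)) Fresh Fresh) (c - int (per (\<not> b)) * int r)"
proof -
  have "\<not> diverging A p (Turn e r # v) u" for A
    using diverging_longer u by metis
  moreover have "int (per b) dvd - int r mod int (per b) + val u \<longleftrightarrow> int (per b) dvd val u - int r"
    by (simp add: dvd_mod_add_val)
  ultimately show ?thesis
    by (auto simp: diverging_steps_Turn[OF u] right_diff_distrib simp del: reduced.simps)
qed

lemma Common_Turn_steps:
  assumes v: "\<And>e r w. v \<noteq> Turn e r # w"
  shows "(Turn e r # u, v) \<in> move_residual b (Common p) c \<longleftrightarrow>
    e = (\<not> b) \<and> reduced p [(\<not> b, r)] \<and>
    (u, v) \<in> move_residual b (Tail 0 Fresh Fresh) (c + int (per b) * int r)"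
proof -
  have "\<not> diverging A p (Turn e r # u) v" for A
    using diverging_longer v by metis
  then show ?thesis
    by (auto simp: diverging_steps_Turn[OF v] algebra_simps simp del: reduced.simps)
qed

lemma Common_steps_steps:
  assumes "\<And>e r w. u \<noteq> Turn e r # w" "\<And>e r w. v \<noteq> Turn e r # w"
  shows "(u, v) \<notin> move_residual b (Common p) c"
proof -
  have "\<not> diverging A p u v" "\<not> diverging A p v u" for A
    using diverging_longer assms by metis+
  then show ?thesis
    by simp
qed

text \<open>The letter that reveals the extra syllable may carry the first letter of the other tail, which is
  why leaving \<open>Common\<close> is followed at once by a one-sided step of the tail.\<close>

lemma move_language_one_counter:
  assumes "0 < k"
  shows "{convolution u v | u v. (u, v) \<in> (\<lambda>s. (encode s, encode (act (Gen_t, b) s))) ` configs}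
    \<in> blind_counter_languages k"
  unfolding move_relation
proof (rule blind_counter_convolutionI_residuals[where S = "move_states b" and \<Lambda> = letters, OF assms])
  show "finite letters" "finite (move_states b)"
    by (fact finite_letters finite_move_states)+
  show "move_residual b q c \<subseteq> lists letters \<times> lists letters" for q c
  proof (cases q)
    case (Common p)
    have "turns Q @ steps N \<in> lists letters" if "reduced p Q" for Q N
      using subsetD[OF phase_words_letters turns_steps_in_phase_words[OF that]] .
    moreover have "reduced p (Q @ [x]) \<Longrightarrow> reduced p Q" for Q x
      by (cases x) (simp add: reduced_snoc)
    ultimately have "u \<in> lists letters \<and> v \<in> lists letters" if "diverging A p u v" for A u v
      using that unfolding diverging_def by blast
    then show ?thesis
      unfolding Common move_residual.simps by blast
  next
    case (Tail \<rho> f f')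
    then show ?thesis
      using phase_words_letters unfolding Tail move_residual.simps by blast
  qed
  show "([], []) \<in> move_residual b q c \<longleftrightarrow> ([], []) \<in> move_residual b q 0 \<and> c = 0" for q c
  proof (cases q)
    case (Common p)
    then show ?thesis
      using Common_steps_steps[of "[]" "[]"] by (simp del: move_residual.simps)
  next
    case (Tail \<rho> f f')
    then show ?thesis
      by (auto simp: val_def)
  qed
  show "(\<forall>c u v. (y = None \<longrightarrow> u = []) \<longrightarrow> (z = None \<longrightarrow> v = []) \<longrightarrow>
        (opt_list y @ u, opt_list z @ v) \<notin> move_residual b q c) \<or>
      (\<exists>q'\<in>move_states b. \<exists>e. \<forall>c u v.
        (y = None \<longrightarrow> u = []) \<and> (z = None \<longrightarrow> v = []) \<and> (opt_list y @ u, opt_list z @ v) \<in> move_residual b q c \<longleftrightarrow>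
        (u, v) \<in> move_residual b q' (c + e))" (is "?dead q \<or> ?live q")
    if yz: "y \<noteq> None \<or> z \<noteq> None" for q y z
  proof -
    have tail: "?dead (Tail \<rho> f f') \<or> ?live (Tail \<rho> f f')" for \<rho> f f'
    proof (cases "advance f y = None \<or> advance f' z = None")
      case True
      then have "?dead (Tail \<rho> f f')"
        by (intro allI impI) (rule Tail_stuck)
      then show ?thesis ..
    next
      case False
      then obtain g g' where g: "advance f y = Some g" "advance f' z = Some g'"
        by auto
      let ?q = "Tail ((\<rho> + val (opt_list y)) mod int (per b)) g g'"
      have "(y = None \<longrightarrow> u = []) \<and> (z = None \<longrightarrow> v = []) \<and>
          (opt_list y @ u, opt_list z @ v) \<in> move_residual b (Tail \<rho> f f') c \<longleftrightarrow>
        (u, v) \<in> move_residual b ?q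
          (c + (int (per (\<not> b)) * val (opt_list y) - int (per b) * val (opt_list z)))" for u v c
        unfolding add_diff_eq Tail_advance_right[OF g(2), symmetric] Tail_advance_left[OF g(1), symmetric]
        by blast
      then have "?live (Tail \<rho> f f')"
        by (intro bexI[of _ ?q] exI allI) simp_all
      then show ?thesis ..
    qed
    show ?thesis
    proof (cases q)
      case (Tail \<rho> f f')
      then show ?thesis using tail by simp
    next
      case (Common p)
      consider (turns) e r e' r' where "y = Some (Turn e r)" "z = Some (Turn e' r')"
        | (push) e r where "\<And>e r. y \<noteq> Some (Turn e r)" "z = Some (Turn e r)"
        | (cancel) e r where "y = Some (Turn e r)" "\<And>e r. z \<noteq> Some (Turn e r)"
        | (steps) "\<And>e r. y \<noteq> Some (Turn e r)" "\<And>e r. z \<noteq> Some (Turn e r)"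
        by metis
      then show ?thesis
      proof cases
        case turns
        show ?thesis
        proof (cases "e = e' \<and> r = r' \<and> reduced p [(e, r)]")
          case True
          then have "\<forall>c u v. (y = None \<longrightarrow> u = []) \<and> (z = None \<longrightarrow> v = []) \<and>
              (opt_list y @ u, opt_list z @ v) \<in> move_residual b q c \<longleftrightarrow>
              (u, v) \<in> move_residual b (Common (Some e)) (c + 0)"
            unfolding turns Common opt_list_simps append_Cons append_Nil Common_Turn_Turn
            by (auto simp del: move_residual.simps reduced.simps)
          then have "?live q"
            by - (rule bexI[of _ "Common (Some e)"], rule exI[of _ 0], assumption, simp)
          then show ?thesis ..
        next
          case False
          then have "?dead q"
            unfolding turns Common opt_list_simps append_Cons append_Nil Common_Turn_Turn
            by (auto simp del: move_residual.simps reduced.simps)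
          then show ?thesis ..
        qed
      next
        case push
        have no_turn: "opt_list y @ u \<noteq> Turn e r # w" if "y = None \<longrightarrow> u = []" for u e r w
          using push(1) that by (cases y) auto
        obtain g where g: "advance Fresh y = Some g"
          using push(1) by (cases "(Fresh, y)" rule: advance.cases) auto
        show ?thesis
        proof (cases "e = b \<and> reduced p [(b, r)]")
          case True
          let ?q = "Tail ((- int r mod int (per b) + val (opt_list y)) mod int (per b)) g Fresh"
          let ?e = "int (per (\<not> b)) * val (opt_list y) - int (per (\<not> b)) * int r"
          have "(y = None \<longrightarrow> u = []) \<and> (opt_list y @ u, Turn e r # v) \<in> move_residual b (Common p) c \<longleftrightarrow>
              (u, v) \<in> move_residual b ?q (c + ?e)" for c u v
            using Common_steps_Turn[OF no_turn, of u e r v b p c] True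
              Tail_advance_left[OF g, of u v b "- int r mod int (per b)" Fresh "c - int (per (\<not> b)) * int r"]
            by (auto simp: algebra_simps simp del: move_residual.simps)
          then have "?live q"
            unfolding push(2) Common by (intro bexI[of _ ?q] exI[of _ ?e] allI) (simp_all del: move_residual.simps)
          then show ?thesis ..
        next
          case False
          have "(opt_list y @ u, Turn e r # v) \<notin> move_residual b (Common p) c"
            if "y = None \<longrightarrow> u = []" for c u v
            unfolding Common_steps_Turn[OF no_turn[OF that]] using False
            by (auto simp del: move_residual.simps reduced.simps)
          then have "?dead q"
            unfolding push(2) Common by (simp del: move_residual.simps)
          then show ?thesis ..
        qed
      next
        case cancel
        have no_turn: "opt_list z @ v \<noteq> Turn e r # w" if "z = None \<longrightarrow> v = []" for v e r w
          using cancel(2) that by (cases z) auto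
        obtain g where g: "advance Fresh z = Some g"
          using cancel(2) by (cases "(Fresh, z)" rule: advance.cases) auto
        show ?thesis
        proof (cases "e = (\<not> b) \<and> reduced p [(\<not> b, r)]")
          case True
          let ?q = "Tail 0 Fresh g"
          let ?e = "int (per b) * int r - int (per b) * val (opt_list z)"
          have "(z = None \<longrightarrow> v = []) \<and> (Turn e r # u, opt_list z @ v) \<in> move_residual b (Common p) c \<longleftrightarrow>
              (u, v) \<in> move_residual b ?q (c + ?e)" for c u v
            using Common_Turn_steps[OF no_turn, of v e r u b p c] True
              Tail_advance_right[OF g, of v u b 0 Fresh "c + int (per b) * int r"]
            by (auto simp: algebra_simps simp del: move_residual.simps)
          then have "?live q"
            unfolding cancel(1) Common by (intro bexI[of _ ?q] exI[of _ ?e] allI) (simp_all del: move_residual.simps)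
          then show ?thesis ..
        next
          case False
          have "(Turn e r # u, opt_list z @ v) \<notin> move_residual b (Common p) c"
            if "z = None \<longrightarrow> v = []" for c u v
            unfolding Common_Turn_steps[OF no_turn[OF that]] using False
            by (auto simp del: move_residual.simps reduced.simps)
          then have "?dead q"
            unfolding cancel(1) Common by (simp del: move_residual.simps)
          then show ?thesis ..
        qed
      next
        case steps
        have "(opt_list y @ u, opt_list z @ v) \<notin> move_residual b (Common p) c"
          if "y = None \<longrightarrow> u = []" "z = None \<longrightarrow> v = []" for c u v
        proof (rule Common_steps_steps)
          show "opt_list y @ u \<noteq> Turn e r # w" for e r w
            using steps(1) that(1) by (cases y) auto
          show "opt_list z @ v \<noteq> Turn e r # w" for e r w
            using steps(2) that(2) by (cases z) auto
        qed
        then have "?dead q"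
          unfolding Common by (intro allI impI)
        then show ?thesis ..
      qed
    qed
  qed
qed simp

subsection \<open>Graph automaticity\<close>

lemma graph_automatic_letters:
  assumes "0 < j" "0 < k"
  shows "graph_automatic (blind_counter_languages j) (blind_counter_languages k) G (BS_gens m n) letters"
proof -
  have gens: "\<exists>y. x = cls [y]" if "x \<in> BS_gens m n" for x
    using that by (auto simp: BS_gens_eq)
  have "{convolution u v | u v. u \<in> encode ` configs \<and> v \<in> encode ` configs \<and> eval v = eval u \<otimes>\<^bsub>G\<^esub> x}
      \<in> blind_counter_languages k" if x: "x \<in> BS_gens m n" for x
  proof -
    obtain g b where "x = cls [(g, b)]"
      using gens[OF x] by auto
    then show ?thesis
      unfolding \<open>x = _\<close> multiplication_language
      using step_language_regular[OF assms(2)] move_language_one_counter[OF assms(2)]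
      by (cases g) simp_all
  qed
  moreover have "encode ` configs \<subseteq> lists letters"
    unfolding encode_configs by (rule phase_words_letters)
  moreover have "\<forall>x\<in>BS_gens m n. inv\<^bsub>G\<^esub> x \<in> BS_gens m n"
    by (auto simp: BS_gens_eq cls_inverse)
  moreover have "BS_gens m n \<subseteq> carrier G"
    by (auto simp: BS_gens_eq)
  ultimately show ?thesis
    unfolding graph_automatic_def
    using bij_betw_eval normal_forms_regular[OF assms(1)] group_BS generate_BS_gens finite_letters
    by blast
qed

end

theorem proposition6p2:
  fixes m n :: nat
  assumes "2 \<le> m" and "m < n"
  shows "\<exists>\<Lambda> :: nat set.
    graph_automatic (blind_counter_languages 3) (blind_counter_languages 3)
      (BS m n) (BS_gens m n) \<Lambda>"
proof -
  interpret baumslag_solitar m n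
    using assms by unfold_locales simp_all
  show ?thesis
    by (rule graph_automatic_nat_alphabet[OF graph_automatic_letters]) simp_all
qed

end
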